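(* Let $d>3$ be an integer and consider a $d$-regular, connected, non-bipartite, simple graph with $n$ vertices and $B=nd/2$ bonds, with arbitrary bond lengths $L_b>0$, quantised with equi-transmitting vertex scattering matrices. Let $\kappa>0$ and let $f\in\mathbb{C}^{2B}$ satisfy $|f_b|<\kappa$ for all directed bonds $b$. Let $T$ be a positive integer and suppose there is $\beta>0$ such that every non-trivial eigenvalue $\mu_i$ ($i=2,\dots,n$) of the connectivity matrix satisfies $|\mu_i|\le d-\beta$. Then $$V(f,B)\le c_d\left(\frac{\kappa^2}{T\beta^2}+\frac{\kappa^2 (d-1)^T\,|\mathcal{C}_{B,2T}|}{B\,T^2}\right),$$ where $c_d$ is a constant depending only on $d$ (in particular not on $B$, $T$, $f$, $\kappa$ or the bond lengths).
   Context: A graph is simple if it has no loops and no multiple edges. Each undirected bond of length $L_b$ gives two directed bonds (the two orientations), of equal length; there are $2B$ directed bonds. For a directed bond $b$ write $o(b)$, $t(b)$ for its origin and terminal vertex and $\bar b$ for its reversal. To each vertex $v$ a unitary $d\times d$ matrix $\sigma_v$ (rows/columns indexed by the $d$ bonds at $v$) is assigned. The bond scattering matrix $S$ is the $2B\times 2B$ matrix with $S_{bc}=0$ unless $t(b)=o(c)$, and otherwise $S_{bc}$ equals the entry of $\sigma_v$, $v=t(b)=o(c)$, in the row of the bond underlying $c$ and the column of the bond underlying $b$ (so $S_{b\bar b}$ is a diagonal entry of $\sigma_v$). The quantisation is equi-transmitting if every $\sigma_v$ has all diagonal entries $0$ and all off-diagonal entries of equal modulus. For $k\in\mathbb{R}$,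 $U(k)$ is the $2B\times2B$ matrix $U(k)_{bc}=e^{ikL_b}S_{bc}$ (unitary). For $f\in\mathbb{C}^{2B}$, $\mathrm{Op}(f)=\mathrm{diag}(f)$. Inner products are $\langle x,y\rangle=\sum_i\bar x_i y_i$. For each $k$ let $\{\phi_j(k)\}_{j=1}^{2B}$ be an orthonormal basis of eigenvectors of $U(k)$; the quantum variance is $$V(f,B)=\frac1{2B}\lim_{K\to\infty}\frac1K\int_0^K\sum_{j=1}^{2B}\Big|\langle\phi_j(k),\mathrm{Op}(f)\phi_j(k)\rangle-\tfrac1{2B}\mathrm{Tr}\,\mathrm{Op}(f)\Big|^2\,dk.$$ The connectivity matrix $C$ is the $n\times n$ matrix with $C_{ij}=1$ if vertices $i,j$ are adjacent and $0$ otherwise; its eigenvalues are $d=\mu_1\ge\mu_2\ge\dots\ge\mu_n$, and for a connected non-bipartite graph $\mu_2,\dots,\mu_n\in(-d,d)$ are called non-trivial. A cycle is a closed path without back-tracking; $\mathcal{C}_{B,t}$ is the set of (undirected) bonds lying on a cycle of length at most $t$, and $|\cdot|$ denotes cardinality. *)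

theory Defs
  imports "HOL-Analysis.Analysis"
begin

definition simple_graph :: "nat \<Rightarrow> (nat \<Rightarrow> nat \<Rightarrow> bool) \<Rightarrow> bool" where
  "simple_graph n E \<longleftrightarrow> (\<forall>u v. E u v \<longrightarrow> u < n \<and> v < n \<and> u \<noteq> v \<and> E v u)"

definition nbrs :: "(nat \<Rightarrow> nat \<Rightarrow> bool) \<Rightarrow> nat \<Rightarrow> nat set" where
  "nbrs E v = {w. E v w}"

definition regular :: "nat \<Rightarrow> (nat \<Rightarrow> nat \<Rightarrow> bool) \<Rightarrow> nat \<Rightarrow> bool" where
  "regular n E d \<longleftrightarrow> (\<forall>v<n. card (nbrs E v) = d)"

definition connected_graph :: "nat \<Rightarrow> (nat \<Rightarrow> nat \<Rightarrow> bool) \<Rightarrow> bool" where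
  "connected_graph n E \<longleftrightarrow> n > 0 \<and> (\<forall>u<n. \<forall>v<n. E\<^sup>*\<^sup>* u v)"

definition bipartite :: "nat \<Rightarrow> (nat \<Rightarrow> nat \<Rightarrow> bool) \<Rightarrow> bool" where
  "bipartite n E \<longleftrightarrow> (\<exists>A::nat set. \<forall>u v. E u v \<longrightarrow> (u \<in> A \<longleftrightarrow> v \<notin> A))"

definition dbonds :: "nat \<Rightarrow> (nat \<Rightarrow> nat \<Rightarrow> bool) \<Rightarrow> (nat \<times> nat) set" where
  "dbonds n E = {(u, v). u < n \<and> v < n \<and> E u v}"

definition ubonds :: "nat \<Rightarrow> (nat \<Rightarrow> nat \<Rightarrow> bool) \<Rightarrow> nat set set" where
  "ubonds n E = {{u, v} | u v. (u, v) \<in> dbonds n E}"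

text \<open>Connectivity matrix eigenvalue (C real symmetric, so real eigenvalues suffice).\<close>
definition conn_eigenvalue :: "nat \<Rightarrow> (nat \<Rightarrow> nat \<Rightarrow> bool) \<Rightarrow> real \<Rightarrow> bool" where
  "conn_eigenvalue n E \<mu> \<longleftrightarrow> (\<exists>x::nat \<Rightarrow> real. (\<exists>i<n. x i \<noteq> 0) \<and>
      (\<forall>i<n. (\<Sum>j<n. (if E i j then 1 else 0) * x j) = \<mu> * x i))"

definition bond_lengths :: "nat \<Rightarrow> (nat \<Rightarrow> nat \<Rightarrow> bool) \<Rightarrow> (nat \<times> nat \<Rightarrow> real) \<Rightarrow> bool" where
  "bond_lengths n E L \<longleftrightarrow> (\<forall>(u, v) \<in> dbonds n E. L (u, v) > 0 \<and> L (v, u) = L (u, v))"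

text \<open>Vertex scattering matrices: sigma v a b is the entry of sigma_v in the row of bond {v,a}
  and the column of bond {v,b} (a, b neighbours of v).\<close>
definition vertex_unitary :: "(nat \<Rightarrow> nat \<Rightarrow> bool) \<Rightarrow> (nat \<Rightarrow> nat \<Rightarrow> nat \<Rightarrow> complex) \<Rightarrow> nat \<Rightarrow> bool" where
  "vertex_unitary E \<sigma> v \<longleftrightarrow> (\<forall>a\<in>nbrs E v. \<forall>b\<in>nbrs E v.
      (\<Sum>c\<in>nbrs E v. cnj (\<sigma> v c a) * \<sigma> v c b) = (if a = b then 1 else 0))"

definition equi_transmitting :: "nat \<Rightarrow> (nat \<Rightarrow> nat \<Rightarrow> bool) \<Rightarrow> (nat \<Rightarrow> nat \<Rightarrow> nat \<Rightarrow> complex) \<Rightarrow> bool" where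
  "equi_transmitting n E \<sigma> \<longleftrightarrow> (\<forall>v<n. vertex_unitary E \<sigma> v \<and>
      (\<forall>a\<in>nbrs E v. \<sigma> v a a = 0) \<and>
      (\<exists>r. \<forall>a\<in>nbrs E v. \<forall>b\<in>nbrs E v. a \<noteq> b \<longrightarrow> cmod (\<sigma> v a b) = r))"

definition bond_scat :: "(nat \<Rightarrow> nat \<Rightarrow> nat \<Rightarrow> complex) \<Rightarrow> nat \<times> nat \<Rightarrow> nat \<times> nat \<Rightarrow> complex" where
  "bond_scat \<sigma> b c = (if snd b = fst c then \<sigma> (snd b) (snd c) (fst b) else 0)"

definition Umat :: "(nat \<times> nat \<Rightarrow> real) \<Rightarrow> (nat \<Rightarrow> nat \<Rightarrow> nat \<Rightarrow> complex) \<Rightarrow> real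
    \<Rightarrow> nat \<times> nat \<Rightarrow> nat \<times> nat \<Rightarrow> complex" where
  "Umat L \<sigma> k b c = exp (\<i> * complex_of_real (k * L b)) * bond_scat \<sigma> b c"

definition inner_D :: "(nat \<times> nat) set \<Rightarrow> (nat \<times> nat \<Rightarrow> complex) \<Rightarrow> (nat \<times> nat \<Rightarrow> complex) \<Rightarrow> complex" where
  "inner_D D x y = (\<Sum>b\<in>D. cnj (x b) * y b)"

definition eigenbasis_family :: "(nat \<times> nat) set \<Rightarrow> (nat \<times> nat \<Rightarrow> real) \<Rightarrow> (nat \<Rightarrow> nat \<Rightarrow> nat \<Rightarrow> complex)
    \<Rightarrow> (real \<Rightarrow> nat \<Rightarrow> nat \<times> nat \<Rightarrow> complex) \<Rightarrow> bool" where
  "eigenbasis_family D L \<sigma> \<phi> \<longleftrightarrow> (\<forall>k. (\<forall>j<card D. \<exists>ev. \<forall>b\<in>D.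
        (\<Sum>c\<in>D. Umat L \<sigma> k b c * \<phi> k j c) = ev * \<phi> k j b) \<and>
      (\<forall>i<card D. \<forall>j<card D. inner_D D (\<phi> k i) (\<phi> k j) = (if i = j then 1 else 0)))"

definition qv_integrand :: "(nat \<times> nat) set \<Rightarrow> (nat \<times> nat \<Rightarrow> complex)
    \<Rightarrow> (real \<Rightarrow> nat \<Rightarrow> nat \<times> nat \<Rightarrow> complex) \<Rightarrow> real \<Rightarrow> real" where
  "qv_integrand D f \<phi> k = (\<Sum>j<card D.
     (cmod (inner_D D (\<phi> k j) (\<lambda>b. f b * \<phi> k j b) - (\<Sum>b\<in>D. f b) / of_nat (card D)))\<^sup>2)"

text \<open>Quantum variance; the limit is taken as a limsup (equal to the limit when it exists).\<close>
definition quantum_variance :: "(nat \<times> nat) set \<Rightarrow> (nat \<times> nat \<Rightarrow> complex)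
    \<Rightarrow> (real \<Rightarrow> nat \<Rightarrow> nat \<times> nat \<Rightarrow> complex) \<Rightarrow> ereal" where
  "quantum_variance D f \<phi> = Limsup at_top (\<lambda>K::real.
      ereal (1 / real (card D) * (1 / K * integral {0..K} (qv_integrand D f \<phi>))))"

text \<open>Closed non-backtracking walks v_0 ... v_{m-1} v_0 (cyclically non-backtracking),
  length m = number of bonds.\<close>
definition closed_nb_walk :: "(nat \<Rightarrow> nat \<Rightarrow> bool) \<Rightarrow> nat list \<Rightarrow> bool" where
  "closed_nb_walk E p \<longleftrightarrow> p \<noteq> [] \<and>
     (\<forall>i<length p. E (p ! i) (p ! ((i + 1) mod length p))) \<and>
     (\<forall>i<length p. p ! ((i + 2) mod length p) \<noteq> p ! i)"

definition cycle_bonds :: "nat \<Rightarrow> (nat \<Rightarrow> nat \<Rightarrow> bool) \<Rightarrow> nat \<Rightarrow> nat set set" where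
  "cycle_bonds n E t = {e \<in> ubonds n E. \<exists>p. closed_nb_walk E p \<and> length p \<le> t \<and>
      (\<exists>i<length p. e = {p ! i, p ! ((i + 1) mod length p)})}"

end

theory Submission
  imports Defs
begin

text \<open>The bound holds for the integrand at every single \<open>k\<close>; no average over \<open>k\<close> is needed.
  Replace \<open>f\<close> by the real and imaginary parts \<open>g\<close> of \<open>f\<close> minus its mean. Since the \<open>\<phi>\<^sub>j\<close> are
  eigenvectors, \<open>\<langle>\<phi>\<^sub>j, g \<phi>\<^sub>j\<rangle>\<close> is unchanged if \<open>g\<close> is replaced by the time average
  \<open>(1/T) \<Sum>t<T. U\<^sup>*\<^sup>t g U\<^sup>t\<close>, so the sum of the squares is at most the squared Hilbert-Schmidt norm of
  this average, which by unitarity is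
  \<open>(1/T\<^sup>2) \<Sum>s,t<T. \<Sum>b,c. g\<^sub>b g\<^sub>c |(U\<^bsup>|s-t|\<^esup>)\<^sub>b\<^sub>c|\<^sup>2\<close>.

  If only one non-backtracking walk of length \<open>t\<close> leads from \<open>b\<close> to \<open>c\<close>, then
  \<open>|(U\<^sup>t)\<^sub>b\<^sub>c|\<^sup>2 = (M\<^sup>t)\<^sub>b\<^sub>c\<close> with the doubly stochastic matrix \<open>M\<^sub>b\<^sub>c = |S\<^sub>b\<^sub>c|\<^sup>2\<close>. Two such walks close up to
  a cycle of length at most \<open>2t\<close> that is reached from \<open>b\<close> in at most \<open>t\<close> steps, so this fails for
  at most a constant times \<open>(d-1)\<^sup>t |\<C>\<^sub>2\<^sub>T|\<close> bonds \<open>b\<close>, each of which contributes \<open>O(\<kappa>\<^sup>2)\<close>.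

  The sums \<open>G = \<Sum>t\<le>s. M\<^sup>t g\<close> satisfy \<open>(1 - M) G = g - M\<^bsup>s+1\<^esup> g\<close>, which is bounded by \<open>2 \<parallel>g\<parallel>\<close>. If
  \<open>h = (1 - M) G\<close> and \<open>a(v)\<close> is the sum of \<open>G\<close> over the bonds leaving \<open>v\<close>, then \<open>(d - C) a\<close> is a
  combination of the outgoing and incoming sums of \<open>h\<close>, and \<open>(d-1) (G - h)(u,v) = a(v) - G(v,u)\<close>;
  hence the spectral gap of \<open>C\<close> gives \<open>\<parallel>G\<parallel> = O(\<parallel>g\<parallel> / \<beta>)\<close>.\<close>

section \<open>Orthonormal families and Gram matrices\<close>

text \<open>The difference between \<open>a\<close> and its projection \<open>p\<close> onto the
  family has squared norm \<open>|a|^2 - sum |alpha j|^2\<close>, which is non-negative.\<close>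

lemma bessel_inequality:
  fixes \<psi> :: "'j \<Rightarrow> 'x \<Rightarrow> complex"
  assumes fin: "finite X" "finite J"
    and orth: "\<And>i j. i \<in> J \<Longrightarrow> j \<in> J \<Longrightarrow> (\<Sum>x\<in>X. cnj (\<psi> i x) * \<psi> j x) = of_bool (i = j)"
  shows "(\<Sum>j\<in>J. (cmod (\<Sum>x\<in>X. cnj (\<psi> j x) * a x))\<^sup>2) \<le> (\<Sum>x\<in>X. (cmod (a x))\<^sup>2)"
proof -
  define \<alpha> where "\<alpha> j = (\<Sum>x\<in>X. cnj (\<psi> j x) * a x)" for j
  define p where "p x = (\<Sum>j\<in>J. \<alpha> j * \<psi> j x)" for x
  have pa: "(\<Sum>x\<in>X. cnj (p x) * a x) = (\<Sum>j\<in>J. of_real ((cmod (\<alpha> j))\<^sup>2))"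
  proof -
    have "(\<Sum>x\<in>X. cnj (p x) * a x) = (\<Sum>x\<in>X. \<Sum>j\<in>J. cnj (\<alpha> j) * (cnj (\<psi> j x) * a x))"
      by (simp add: p_def sum_distrib_right mult.assoc)
    also have "\<dots> = (\<Sum>j\<in>J. cnj (\<alpha> j) * \<alpha> j)"
      by (subst sum.swap) (simp add: \<alpha>_def sum_distrib_left)
    finally show ?thesis
      by (simp only: complex_norm_square mult.commute)
  qed
  have pp: "(\<Sum>x\<in>X. cnj (p x) * p x) = (\<Sum>j\<in>J. of_real ((cmod (\<alpha> j))\<^sup>2))"
  proof -
    have "(\<Sum>x\<in>X. cnj (p x) * p x)
        = (\<Sum>x\<in>X. \<Sum>i\<in>J. \<Sum>j\<in>J. cnj (\<alpha> i) * \<alpha> j * (cnj (\<psi> i x) * \<psi> j x))"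
      unfolding p_def cnj_sum sum_product by (simp add: algebra_simps)
    also have "\<dots> = (\<Sum>i\<in>J. \<Sum>x\<in>X. \<Sum>j\<in>J. cnj (\<alpha> i) * \<alpha> j * (cnj (\<psi> i x) * \<psi> j x))"
      by (rule sum.swap)
    also have "\<dots> = (\<Sum>i\<in>J. \<Sum>j\<in>J. \<Sum>x\<in>X. cnj (\<alpha> i) * \<alpha> j * (cnj (\<psi> i x) * \<psi> j x))"
      by (intro sum.cong refl sum.swap)
    also have "\<dots> = (\<Sum>i\<in>J. \<Sum>j\<in>J. cnj (\<alpha> i) * \<alpha> j * of_bool (i = j))"
      by (intro sum.cong refl) (simp add: orth flip: sum_distrib_left)
    also have "\<dots> = (\<Sum>i\<in>J. cnj (\<alpha> i) * \<alpha> i)"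
      using fin by (intro sum.cong refl) (simp add: of_bool_def if_distrib sum.delta cong: if_cong)
    finally show ?thesis
      by (simp only: complex_norm_square mult.commute)
  qed
  have exp: "(cmod (a x - p x))\<^sup>2 = (cmod (a x))\<^sup>2 + Re (cnj (p x) * p x) - 2 * Re (cnj (p x) * a x)" for x
    unfolding cmod_power2 by (simp add: power2_eq_square algebra_simps)
  have "0 \<le> (\<Sum>x\<in>X. (cmod (a x - p x))\<^sup>2)"
    by (simp add: sum_nonneg)
  also have "\<dots> = (\<Sum>x\<in>X. (cmod (a x))\<^sup>2) + Re (\<Sum>x\<in>X. cnj (p x) * p x) - 2 * Re (\<Sum>x\<in>X. cnj (p x) * a x)"
    by (simp only: exp Re_sum sum.distrib sum_subtractf sum_distrib_left)
  also have "\<dots> = (\<Sum>x\<in>X. (cmod (a x))\<^sup>2) - (\<Sum>j\<in>J. (cmod (\<alpha> j))\<^sup>2)"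
    unfolding pa pp by (simp flip: of_real_sum)
  finally show ?thesis
    by (simp add: \<alpha>_def)
qed

text \<open>Both sides are the trace of the square of a weighted sum of rank-one operators:
  expanding the moduli gives one fourfold sum, grouped by pairs from \<open>X\<close> or by pairs
  from \<open>I\<close>. Used with \<open>w = 1\<close> for unitarity and with \<open>w = g\<close>
  for the time average.\<close>

lemma gram_hilbert_schmidt:
  fixes u :: "'i \<Rightarrow> 'x \<Rightarrow> complex" and w :: "'i \<Rightarrow> real"
  shows "(\<Sum>(x, y)\<in>X \<times> X. (cmod (\<Sum>i\<in>I. w i * cnj (u i x) * u i y))\<^sup>2)
    = (\<Sum>(i, j)\<in>I \<times> I. w i * w j * (cmod (\<Sum>x\<in>X. cnj (u i x) * u j x))\<^sup>2)"
proof -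
  have sq: "complex_of_real ((cmod (\<Sum>i\<in>J. h i))\<^sup>2) = (\<Sum>i\<in>J. \<Sum>j\<in>J. h i * cnj (h j))"
    for J and h :: "'k \<Rightarrow> complex"
    unfolding complex_norm_square cnj_sum sum_product ..
  have "complex_of_real (\<Sum>(x, y)\<in>X \<times> X. (cmod (\<Sum>i\<in>I. w i * cnj (u i x) * u i y))\<^sup>2)
     = (\<Sum>x\<in>X. \<Sum>y\<in>X. complex_of_real ((cmod (\<Sum>i\<in>I. w i * cnj (u i x) * u i y))\<^sup>2))"
    by (simp only: of_real_sum flip: sum.cartesian_product)
  also have "\<dots> = (\<Sum>x\<in>X. \<Sum>y\<in>X. \<Sum>i\<in>I. \<Sum>j\<in>I. w i * w j * (cnj (u i x) * u j x * (u i y * cnj (u j y))))"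
    unfolding sq by (simp add: mult_ac)
  also have "\<dots> = (\<Sum>x\<in>X. \<Sum>i\<in>I. \<Sum>y\<in>X. \<Sum>j\<in>I. w i * w j * (cnj (u i x) * u j x * (u i y * cnj (u j y))))"
    by (intro sum.cong refl sum.swap)
  also have "\<dots> = (\<Sum>i\<in>I. \<Sum>x\<in>X. \<Sum>y\<in>X. \<Sum>j\<in>I. w i * w j * (cnj (u i x) * u j x * (u i y * cnj (u j y))))"
    by (rule sum.swap)
  also have "\<dots> = (\<Sum>i\<in>I. \<Sum>x\<in>X. \<Sum>j\<in>I. \<Sum>y\<in>X. w i * w j * (cnj (u i x) * u j x * (u i y * cnj (u j y))))"
    by (intro sum.cong refl sum.swap)
  also have "\<dots> = (\<Sum>i\<in>I. \<Sum>j\<in>I. \<Sum>x\<in>X. \<Sum>y\<in>X. w i * w j * (cnj (u i x) * u j x * (u i y * cnj (u j y))))"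
    by (intro sum.cong refl sum.swap)
  also have "\<dots> = (\<Sum>i\<in>I. \<Sum>j\<in>I. w i * w j * complex_of_real ((cmod (\<Sum>x\<in>X. cnj (u i x) * u j x))\<^sup>2))"
    unfolding sq sum_distrib_left by simp
  also have "\<dots> = complex_of_real (\<Sum>(i, j)\<in>I \<times> I. w i * w j * (cmod (\<Sum>x\<in>X. cnj (u i x) * u j x))\<^sup>2)"
    by (simp only: of_real_sum of_real_mult flip: sum.cartesian_product)
  finally show ?thesis
    using of_real_eq_iff by blast
qed

section \<open>Powers of matrices with orthonormal rows\<close>

text \<open>Over a general semiring, as the same recursion serves for the complex evolution and, in
  the natural numbers, for counting walks.\<close>

primrec mpow :: "'b set \<Rightarrow> ('b \<Rightarrow> 'b \<Rightarrow> 'a::comm_semiring_1) \<Rightarrow> nat \<Rightarrow> 'b \<Rightarrow> 'b \<Rightarrow> 'a" where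
  "mpow D A 0 b c = of_bool (b = c)"
| "mpow D A (Suc t) b c = (\<Sum>x\<in>D. A b x * mpow D A t x c)"

lemma mpow_add:
  assumes "finite D" "b \<in> D"
  shows "mpow D A (s + t) b c = (\<Sum>x\<in>D. mpow D A s b x * mpow D A t x c)"
  using assms(2)
proof (induction s arbitrary: b)
  case 0
  then show ?case
    using assms(1) by (simp add: of_bool_def if_distrib if_distribR sum.delta cong: if_cong)
next
  case (Suc s)
  have "mpow D A (Suc s + t) b c = (\<Sum>x\<in>D. \<Sum>y\<in>D. A b x * mpow D A s x y * mpow D A t y c)"
    by (simp add: Suc sum_distrib_left mult.assoc)
  also have "\<dots> = (\<Sum>y\<in>D. \<Sum>x\<in>D. A b x * mpow D A s x y * mpow D A t y c)"
    by (rule sum.swap)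
  finally show ?case
    by (simp add: sum_distrib_right)
qed

text \<open>Row form of unitarity, which the columns of the vertex matrices deliver directly;
  orthonormality of the columns is derived below.\<close>

definition row_unitary :: "'b set \<Rightarrow> ('b \<Rightarrow> 'b \<Rightarrow> complex) \<Rightarrow> bool" where
  "row_unitary D U \<longleftrightarrow> (\<forall>b\<in>D. \<forall>b'\<in>D. (\<Sum>c\<in>D. U b c * cnj (U b' c)) = of_bool (b = b'))"

lemma row_unitary_mpow_orthonormal:
  assumes "finite D" "row_unitary D U" "b \<in> D" "b' \<in> D"
  shows "(\<Sum>c\<in>D. mpow D U t b c * cnj (mpow D U t b' c)) = of_bool (b = b')"
  using assms(3,4)
proof (induction t arbitrary: b b')
  case 0
  have "(\<Sum>c\<in>D. mpow D U 0 b c * cnj (mpow D U 0 b' c)) = (\<Sum>c\<in>D. if c = b then of_bool (b = b') else 0)"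
    by (intro sum.cong refl) auto
  then show ?case
    using assms(1) 0 by simp
next
  case (Suc t)
  have "(\<Sum>c\<in>D. mpow D U (Suc t) b c * cnj (mpow D U (Suc t) b' c))
      = (\<Sum>c\<in>D. \<Sum>x\<in>D. \<Sum>y\<in>D. U b x * cnj (U b' y) * (mpow D U t x c * cnj (mpow D U t y c)))"
    unfolding mpow.simps cnj_sum sum_product by (simp add: mult_ac)
  also have "\<dots> = (\<Sum>x\<in>D. \<Sum>c\<in>D. \<Sum>y\<in>D. U b x * cnj (U b' y) * (mpow D U t x c * cnj (mpow D U t y c)))"
    by (rule sum.swap)
  also have "\<dots> = (\<Sum>x\<in>D. \<Sum>y\<in>D. \<Sum>c\<in>D. U b x * cnj (U b' y) * (mpow D U t x c * cnj (mpow D U t y c)))"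
    by (intro sum.cong refl sum.swap)
  also have "\<dots> = (\<Sum>x\<in>D. \<Sum>y\<in>D. U b x * cnj (U b' y) * of_bool (x = y))"
    by (intro sum.cong refl) (simp add: Suc.IH flip: sum_distrib_left)
  also have "\<dots> = (\<Sum>x\<in>D. U b x * cnj (U b' x))"
    using assms(1) by (intro sum.cong refl) (simp add: of_bool_def if_distrib sum.delta cong: if_cong)
  finally show ?case
    using assms(2) Suc.prems by (simp add: row_unitary_def)
qed

text \<open>Correlations between two times thus depend only on the time difference: the common
  factor \<open>U^t\<close> cancels against its adjoint.\<close>

lemma row_unitary_mpow_diff:
  assumes "finite D" "row_unitary D U" "b \<in> D" "b' \<in> D"
  shows "(\<Sum>c\<in>D. mpow D U (r + t) b c * cnj (mpow D U t b' c)) = mpow D U r b b'"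
proof -
  have "(\<Sum>c\<in>D. mpow D U (r + t) b c * cnj (mpow D U t b' c))
      = (\<Sum>c\<in>D. \<Sum>x\<in>D. mpow D U r b x * (mpow D U t x c * cnj (mpow D U t b' c)))"
    using assms by (simp add: mpow_add sum_distrib_right mult.assoc)
  also have "\<dots> = (\<Sum>x\<in>D. \<Sum>c\<in>D. mpow D U r b x * (mpow D U t x c * cnj (mpow D U t b' c)))"
    by (rule sum.swap)
  also have "\<dots> = (\<Sum>x\<in>D. mpow D U r b x * of_bool (x = b'))"
    using assms by (intro sum.cong refl) (simp add: row_unitary_mpow_orthonormal flip: sum_distrib_left)
  also have "\<dots> = mpow D U r b b'"
    using assms by (simp add: of_bool_def if_distrib sum.delta cong: if_cong)
  finally show ?thesis .
qed

lemma row_unitary_mpow_row_sum: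
  assumes "finite D" "row_unitary D U" "b \<in> D"
  shows "(\<Sum>c\<in>D. (cmod (mpow D U t b c))\<^sup>2) = 1"
proof -
  have "complex_of_real (\<Sum>c\<in>D. (cmod (mpow D U t b c))\<^sup>2) = 1"
    using row_unitary_mpow_orthonormal[OF assms(1,2) assms(3) assms(3), of t]
    by (simp add: complex_norm_square of_real_sum del: of_real_power)
  then show ?thesis
    using of_real_eq_1_iff by blast
qed

text \<open>For \<open>G\<close>, the adjoint of \<open>U\<close> times \<open>U\<close>, the
  squared Hilbert-Schmidt norm and the trace both equal \<open>card D\<close> by row orthonormality.
  So \<open>G - 1\<close> has squared norm \<open>card D - 2 card D + card D = 0\<close>.\<close>

lemma row_unitary_column_orthonormal:
  assumes fin: "finite D" and U: "row_unitary D U" and "c \<in> D" "c' \<in> D"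
  shows "(\<Sum>b\<in>D. cnj (U b c) * U b c') = of_bool (c = c')"
proof -
  define G where "G x y = (\<Sum>b\<in>D. cnj (U b x) * U b y)" for x y
  have U1: "(\<Sum>x\<in>D. cnj (U b x) * U b' x) = of_bool (b = b')" if "b \<in> D" "b' \<in> D" for b b'
    using U that by (auto simp: row_unitary_def mult.commute)
  have HS: "(\<Sum>(x, y)\<in>D \<times> D. (cmod (G x y))\<^sup>2) = card D"
  proof -
    have "(\<Sum>(x, y)\<in>D \<times> D. (cmod (G x y))\<^sup>2)
        = (\<Sum>(b, b')\<in>D \<times> D. (cmod (\<Sum>x\<in>D. cnj (U b x) * U b' x))\<^sup>2)"
      using gram_hilbert_schmidt[of "\<lambda>_. 1" U D D] by (simp add: G_def)
    also have "\<dots> = (\<Sum>(b, b')\<in>D \<times> D. of_bool (b = b'))"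
      by (intro sum.cong refl) (auto simp: U1)
    also have "\<dots> = (\<Sum>b\<in>D. \<Sum>b'\<in>D. of_bool (b = b'))"
      by (simp add: sum.cartesian_product)
    also have "\<dots> = card D"
      using fin by (simp add: of_bool_def if_distrib sum.delta cong: if_cong)
    finally show ?thesis .
  qed
  have tr: "(\<Sum>x\<in>D. G x x) = card D"
  proof -
    have "(\<Sum>x\<in>D. G x x) = (\<Sum>b\<in>D. \<Sum>x\<in>D. cnj (U b x) * U b x)"
      unfolding G_def by (rule sum.swap)
    then show ?thesis
      by (simp add: U1)
  qed
  have exp: "(cmod (z - of_bool Q))\<^sup>2 = (cmod z)\<^sup>2 + of_bool Q - 2 * (of_bool Q * Re z)" for z Q
    unfolding cmod_power2 by (cases Q) (simp_all add: power2_eq_square algebra_simps)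
  have "(\<Sum>(x, y)\<in>D \<times> D. (cmod (G x y - of_bool (x = y)))\<^sup>2)
     = (\<Sum>(x, y)\<in>D \<times> D. (cmod (G x y))\<^sup>2) + (\<Sum>x\<in>D. \<Sum>y\<in>D. of_bool (x = y))
       - 2 * (\<Sum>x\<in>D. \<Sum>y\<in>D. of_bool (x = y) * Re (G x y))"
    unfolding exp sum.cartesian_product case_prod_beta by (simp add: sum.distrib sum_subtractf sum_distrib_left)
  also have "\<dots> = card D + card D - 2 * Re (\<Sum>x\<in>D. G x x)"
    using fin by (simp add: HS of_bool_def if_distrib if_distribR sum.delta cong: if_cong)
  also have "\<dots> = 0"
    by (simp add: tr)
  finally have "(\<Sum>p\<in>D \<times> D. (cmod (G (fst p) (snd p) - of_bool (fst p = snd p)))\<^sup>2) = 0"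
    by (simp add: case_prod_beta)
  then have "\<forall>p\<in>D \<times> D. (cmod (G (fst p) (snd p) - of_bool (fst p = snd p)))\<^sup>2 = 0"
    using fin by (subst (asm) sum_nonneg_eq_0_iff) auto
  then show ?thesis
    using assms(3,4) by (force simp: G_def)
qed

text \<open>Orthonormal columns make \<open>U\<close> an isometry; comparing the norms of
  \<open>U \<phi>\<close> and \<open>l \<phi>\<close> gives \<open>|l|^2 = 1\<close>.\<close>

lemma row_unitary_eigenvalue_unimodular:
  assumes fin: "finite D" and U: "row_unitary D U"
    and ev: "\<And>b. b \<in> D \<Longrightarrow> (\<Sum>c\<in>D. U b c * \<phi> c) = l * \<phi> b"
    and nrm: "(\<Sum>b\<in>D. cnj (\<phi> b) * \<phi> b) = 1"
  shows "cmod l = 1"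
proof -
  have "(\<Sum>b\<in>D. cnj (l * \<phi> b) * (l * \<phi> b)) = (\<Sum>b\<in>D. cnj (\<Sum>c\<in>D. U b c * \<phi> c) * (\<Sum>c\<in>D. U b c * \<phi> c))"
    by (intro sum.cong refl) (simp only: ev)
  also have "\<dots> = (\<Sum>b\<in>D. \<Sum>c\<in>D. \<Sum>c'\<in>D. cnj (\<phi> c) * \<phi> c' * (cnj (U b c) * U b c'))"
    unfolding cnj_sum sum_product by (simp add: mult_ac)
  also have "\<dots> = (\<Sum>c\<in>D. \<Sum>b\<in>D. \<Sum>c'\<in>D. cnj (\<phi> c) * \<phi> c' * (cnj (U b c) * U b c'))"
    by (rule sum.swap)
  also have "\<dots> = (\<Sum>c\<in>D. \<Sum>c'\<in>D. \<Sum>b\<in>D. cnj (\<phi> c) * \<phi> c' * (cnj (U b c) * U b c'))"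
    by (intro sum.cong refl sum.swap)
  also have "\<dots> = (\<Sum>c\<in>D. \<Sum>c'\<in>D. cnj (\<phi> c) * \<phi> c' * of_bool (c = c'))"
    by (intro sum.cong refl) (simp add: row_unitary_column_orthonormal[OF fin U] flip: sum_distrib_left)
  also have "\<dots> = (\<Sum>c\<in>D. cnj (\<phi> c) * \<phi> c)"
    using fin by (intro sum.cong refl) (simp add: of_bool_def if_distrib sum.delta cong: if_cong)
  finally have "(\<Sum>b\<in>D. cnj (l * \<phi> b) * (l * \<phi> b)) = 1"
    by (simp add: nrm)
  moreover have "(\<Sum>b\<in>D. cnj (l * \<phi> b) * (l * \<phi> b)) = (l * cnj l) * (\<Sum>b\<in>D. cnj (\<phi> b) * \<phi> b)"
    by (simp add: sum_distrib_left algebra_simps)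
  ultimately have "l * cnj l = 1"
    by (simp add: nrm)
  then have "(cmod l)\<^sup>2 = 1"
    by (metis complex_norm_square of_real_eq_1_iff)
  then show ?thesis
    by (simp add: power2_eq_1_iff) (metis abs_norm_cancel abs_neg_one norm_ge_zero one_neq_neg_one)
qed

lemma mpow_eigenvector:
  assumes "\<And>b. b \<in> D \<Longrightarrow> (\<Sum>c\<in>D. A b c * \<phi> c) = l * \<phi> b" "b \<in> D" "finite D"
  shows "(\<Sum>c\<in>D. mpow D A t b c * \<phi> c) = l ^ t * \<phi> b"
  using assms(2)
proof (induction t arbitrary: b)
  case 0
  then show ?case
    using assms(3) by (simp add: of_bool_def if_distrib if_distribR sum.delta cong: if_cong)
next
  case (Suc t)
  have "(\<Sum>c\<in>D. mpow D A (Suc t) b c * \<phi> c) = (\<Sum>c\<in>D. \<Sum>x\<in>D. A b x * (mpow D A t x c * \<phi> c))"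
    by (simp add: sum_distrib_right mult.assoc)
  also have "\<dots> = (\<Sum>x\<in>D. A b x * (\<Sum>c\<in>D. mpow D A t x c * \<phi> c))"
    by (subst sum.swap) (simp add: sum_distrib_left)
  also have "\<dots> = (\<Sum>x\<in>D. A b x * (l ^ t * \<phi> x))"
    by (simp add: Suc.IH)
  also have "\<dots> = l ^ t * (\<Sum>x\<in>D. A b x * \<phi> x)"
    by (simp add: sum_distrib_left mult.left_commute)
  finally show ?case
    by (simp only: assms(1)[OF Suc.prems] power_Suc2 mult.assoc)
qed

section \<open>Time averages of observables\<close>

text \<open>\<open>max s t - min s t\<close> is the distance of \<open>s\<close> and
  \<open>t\<close> within the natural numbers. Doubling the half \<open>t \<le> s\<close> of the
  square counts the diagonal once too often.\<close>

lemma sum_absdiff_eq: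
  fixes h :: "nat \<Rightarrow> real"
  shows "(\<Sum>s<T. \<Sum>t<T. h (max s t - min s t)) = 2 * (\<Sum>s<T. \<Sum>t\<le>s. h t) - T * h 0"
proof (induction T)
  case (Suc T)
  have 1: "(\<Sum>t<T. h (max T t - min T t)) = (\<Sum>t<T. h (Suc t))"
  proof -
    have "(\<Sum>t<T. h (max T t - min T t)) = (\<Sum>t<T. h (T - t))"
      by (intro sum.cong refl) auto
    also have "\<dots> = (\<Sum>t<T. h (T - (T - Suc t)))"
      by (rule sum.nat_diff_reindex[symmetric])
    also have "\<dots> = (\<Sum>t<T. h (Suc t))"
      by (intro sum.cong refl) auto
    finally show ?thesis .
  qed
  have 2: "(\<Sum>s<T. h (max s T - min s T)) = (\<Sum>t<T. h (Suc t))"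
    using 1 by (simp add: max.commute min.commute)
  have 3: "(\<Sum>t\<le>T. h t) = h 0 + (\<Sum>t<T. h (Suc t))"
    by (subst lessThan_Suc_atMost[symmetric]) (rule sum.lessThan_Suc_shift)
  have "(\<Sum>s<Suc T. \<Sum>t<Suc T. h (max s t - min s t))
     = (\<Sum>s<T. \<Sum>t<T. h (max s t - min s t)) + (\<Sum>s<T. h (max s T - min s T)) + (\<Sum>t<T. h (max T t - min T t)) + h 0"
    by (simp add: sum.distrib)
  then show ?case
    using Suc 1 2 3 by (simp add: algebra_simps)
qed simp

lemma sum_expectation_sq_le:
  fixes g :: "'b \<Rightarrow> real" and \<phi> :: "'j \<Rightarrow> 'b \<Rightarrow> complex"
  assumes fin: "finite D" "finite J" and U: "row_unitary D U"
    and ev: "\<And>j. j \<in> J \<Longrightarrow> \<exists>l. \<forall>b\<in>D. (\<Sum>c\<in>D. U b c * \<phi> j c) = l * \<phi> j b"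
    and orth: "\<And>i j. i \<in> J \<Longrightarrow> j \<in> J \<Longrightarrow> (\<Sum>b\<in>D. cnj (\<phi> i b) * \<phi> j b) = of_bool (i = j)"
  shows "(real T)\<^sup>2 * (\<Sum>j\<in>J. (\<Sum>b\<in>D. g b * (cmod (\<phi> j b))\<^sup>2)\<^sup>2)
    \<le> 2 * (\<Sum>s<T. \<Sum>t\<le>s. \<Sum>b\<in>D. \<Sum>c\<in>D. g b * g c * (cmod (mpow D U t b c))\<^sup>2)"
proof -
  define q where "q t = (\<Sum>b\<in>D. \<Sum>c\<in>D. g b * g c * (cmod (mpow D U t b c))\<^sup>2)" for t
  define I where "I = {..<T} \<times> D"
  define w :: "nat \<times> 'b \<Rightarrow> real" where "w i = g (snd i)" for i
  define u where "u i x = mpow D U (fst i) (snd i) x" for i x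
  \<comment> \<open>The entries of \<open>T\<close> times the time average of \<open>g\<close>,
    built from the rows \<open>u i\<close> of the powers of \<open>U\<close>.\<close>
  define a where "a p = (\<Sum>i\<in>I. w i * cnj (u i (fst p)) * u i (snd p))" for p
  \<comment> \<open>The projection onto \<open>\<phi> j\<close> read as a vector over
    \<open>D \<times> D\<close>; these vectors inherit orthonormality, so Bessel's inequality
    applies to \<open>a\<close>.\<close>
  define \<psi> where "\<psi> j p = \<phi> j (fst p) * cnj (\<phi> j (snd p))" for j p
  have \<psi>: "(\<Sum>p\<in>D \<times> D. cnj (\<psi> i p) * \<psi> j p) = of_bool (i = j)" if "i \<in> J" "j \<in> J" for i j
  proof -
    have "(\<Sum>p\<in>D \<times> D. cnj (\<psi> i p) * \<psi> j p)
        = (\<Sum>x\<in>D. cnj (\<phi> i x) * \<phi> j x) * (\<Sum>x\<in>D. cnj (\<phi> j x) * \<phi> i x)"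
      unfolding \<psi>_def sum_product sum.cartesian_product case_prod_beta by (simp add: mult_ac)
    then show ?thesis
      using orth that by auto
  qed
  have expec: "(\<Sum>p\<in>D \<times> D. cnj (\<psi> j p) * a p) = of_real (T * (\<Sum>b\<in>D. g b * (cmod (\<phi> j b))\<^sup>2))"
    if j: "j \<in> J" for j
  proof -
    obtain l where l: "\<And>b. b \<in> D \<Longrightarrow> (\<Sum>c\<in>D. U b c * \<phi> j c) = l * \<phi> j b"
      using ev[OF j] by blast
    \<comment> \<open>This makes the phases \<open>l ^ t\<close> drop out, so that each time
      contributes the same expectation value.\<close>
    have l1: "cmod l = 1"
      using row_unitary_eigenvalue_unimodular[OF fin(1) U l] orth[OF j j] by simp
    have "(\<Sum>p\<in>D \<times> D. cnj (\<psi> j p) * a p)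
        = (\<Sum>i\<in>I. \<Sum>p\<in>D \<times> D. w i * ((cnj (u i (fst p) * \<phi> j (fst p))) * (u i (snd p) * \<phi> j (snd p))))"
      unfolding a_def \<psi>_def sum_distrib_left by (subst sum.swap) (simp add: algebra_simps)
    also have "\<dots> = (\<Sum>i\<in>I. w i * (cnj (\<Sum>x\<in>D. u i x * \<phi> j x) * (\<Sum>x\<in>D. u i x * \<phi> j x)))"
      unfolding sum_distrib_left[symmetric] cnj_sum
      by (simp only: sum_product sum.cartesian_product case_prod_beta')
    also have "\<dots> = (\<Sum>i\<in>I. of_real (w i * (cmod (\<phi> j (snd i)))\<^sup>2))"
    proof (intro sum.cong refl)
      fix i assume "i \<in> I"
      then have "(\<Sum>x\<in>D. u i x * \<phi> j x) = l ^ fst i * \<phi> j (snd i)"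
        unfolding u_def I_def using mpow_eigenvector[OF l _ fin(1)] by auto
      moreover have "cnj z * z = of_real ((cmod z)\<^sup>2)" for z
        by (simp add: complex_norm_square mult.commute del: of_real_power)
      ultimately show "w i * (cnj (\<Sum>x\<in>D. u i x * \<phi> j x) * (\<Sum>x\<in>D. u i x * \<phi> j x))
          = of_real (w i * (cmod (\<phi> j (snd i)))\<^sup>2)"
        by (simp only: norm_mult norm_power l1) simp
    qed
    also have "\<dots> = of_real (\<Sum>t<T. \<Sum>b\<in>D. g b * (cmod (\<phi> j b))\<^sup>2)"
      unfolding I_def w_def sum.cartesian_product case_prod_beta' of_real_sum ..
    finally show ?thesis
      by simp
  qed
  have "(real T)\<^sup>2 * (\<Sum>j\<in>J. (\<Sum>b\<in>D. g b * (cmod (\<phi> j b))\<^sup>2)\<^sup>2)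
      = (\<Sum>j\<in>J. (cmod (\<Sum>p\<in>D \<times> D. cnj (\<psi> j p) * a p))\<^sup>2)"
    unfolding sum_distrib_left
    by (intro sum.cong refl) (simp only: expec norm_of_real power2_abs power_mult_distrib)
  also have "\<dots> \<le> (\<Sum>p\<in>D \<times> D. (cmod (a p))\<^sup>2)"
    using bessel_inequality[of "D \<times> D" J \<psi> a] fin \<psi> by blast
  also have "\<dots> = (\<Sum>(i, j)\<in>I \<times> I. w i * w j * (cmod (\<Sum>x\<in>D. cnj (u i x) * u j x))\<^sup>2)"
    using gram_hilbert_schmidt[of w u I D] by (simp add: a_def case_prod_beta)
  also have "\<dots> = (\<Sum>i\<in>I. \<Sum>j\<in>I. w i * w j * (cmod (\<Sum>x\<in>D. cnj (u i x) * u j x))\<^sup>2)"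
    by (simp add: sum.cartesian_product)
  also have "\<dots> = (\<Sum>s<T. \<Sum>b\<in>D. \<Sum>t<T. \<Sum>c\<in>D. g b * g c * (cmod (\<Sum>x\<in>D. cnj (mpow D U s b x) * mpow D U t c x))\<^sup>2)"
    unfolding I_def w_def u_def sum.cartesian_product' by simp
  also have "\<dots> = (\<Sum>s<T. \<Sum>t<T. \<Sum>b\<in>D. \<Sum>c\<in>D. g b * g c * (cmod (\<Sum>x\<in>D. cnj (mpow D U s b x) * mpow D U t c x))\<^sup>2)"
    by (intro sum.cong refl sum.swap)
  \<comment> \<open>The inner product of row \<open>b\<close> at time \<open>s\<close> and row
    \<open>c\<close> at time \<open>t\<close> is, in modulus, an entry of \<open>U\<close> to the
    power of the time distance. For \<open>s \<le> t\<close> the roles of \<open>b\<close> and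
    \<open>c\<close> are exchanged, and the symmetry of the double sum restores them.\<close>
  also have "\<dots> = (\<Sum>s<T. \<Sum>t<T. q (max s t - min s t))"
  proof (intro sum.cong refl)
    fix s t
    show "(\<Sum>b\<in>D. \<Sum>c\<in>D. g b * g c * (cmod (\<Sum>x\<in>D. cnj (mpow D U s b x) * mpow D U t c x))\<^sup>2) = q (max s t - min s t)"
    proof (cases "s \<le> t")
      case True
      have "cmod (\<Sum>x\<in>D. cnj (mpow D U s b x) * mpow D U t c x) = cmod (mpow D U (t - s) c b)"
        if "b \<in> D" "c \<in> D" for b c
        using row_unitary_mpow_diff[OF fin(1) U that(2,1), of "t - s" s] True by (simp add: mult.commute)
      then have "(\<Sum>b\<in>D. \<Sum>c\<in>D. g b * g c * (cmod (\<Sum>x\<in>D. cnj (mpow D U s b x) * mpow D U t c x))\<^sup>2)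
        = (\<Sum>b\<in>D. \<Sum>c\<in>D. g c * g b * (cmod (mpow D U (t - s) c b))\<^sup>2)"
        by (intro sum.cong refl) simp
      also have "\<dots> = q (t - s)"
        unfolding q_def by (rule sum.swap)
      finally show ?thesis
        using True by simp
    next
      case False
      have "cmod (\<Sum>x\<in>D. cnj (mpow D U s b x) * mpow D U t c x) = cmod (mpow D U (s - t) b c)"
        if "b \<in> D" "c \<in> D" for b c
      proof -
        have "cmod (\<Sum>x\<in>D. cnj (mpow D U s b x) * mpow D U t c x)
            = cmod (cnj (\<Sum>x\<in>D. mpow D U s b x * cnj (mpow D U t c x)))"
          by simp
        also have "\<dots> = cmod (mpow D U (s - t) b c)"
          using row_unitary_mpow_diff[OF fin(1) U that, of "s - t" t] False by (simp only: complex_mod_cnj) simp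
        finally show ?thesis .
      qed
      then show ?thesis
        using False by (simp add: q_def)
    qed
  qed
  also have "\<dots> = 2 * (\<Sum>s<T. \<Sum>t\<le>s. q t) - T * q 0"
    by (rule sum_absdiff_eq)
  \<comment> \<open>The diagonal term dropped here is \<open>T\<close> times \<open>q 0\<close>, a
    sum of squares.\<close>
  also have "\<dots> \<le> 2 * (\<Sum>s<T. \<Sum>t\<le>s. q t)"
  proof -
    have "q 0 = (\<Sum>b\<in>D. \<Sum>c\<in>D. if b = c then g b * g c else 0)"
      unfolding q_def by (intro sum.cong refl) simp
    also have "\<dots> = (\<Sum>b\<in>D. g b * g b)"
      using fin by simp
    also have "\<dots> \<ge> 0"
      by (simp add: sum_nonneg)
    finally show ?thesis
      by simp
  qed
  finally show ?thesis
    by (simp add: q_def)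
qed

section \<open>Non-backtracking random walk on a regular graph\<close>

lemma sum_sq_le_card:
  fixes f :: "'a \<Rightarrow> real"
  shows "(\<Sum>x\<in>S. f x)\<^sup>2 \<le> card S * (\<Sum>x\<in>S. (f x)\<^sup>2)"
  using Cauchy_Schwarz_ineq_sum[of "\<lambda>_. 1" f S] by simp

lemma sum_mult_le_L2_set: "(\<Sum>x\<in>S. f x * g x) \<le> L2_set f S * L2_set g S"
proof -
  have "(\<Sum>x\<in>S. f x * g x) \<le> (\<Sum>x\<in>S. \<bar>f x\<bar> * \<bar>g x\<bar>)"
    by (intro sum_mono) (simp flip: abs_mult)
  then show ?thesis
    using L2_set_mult_ineq order_trans by blast
qed

lemma L2_set_sq: "(L2_set f S)\<^sup>2 = (\<Sum>x\<in>S. (f x)\<^sup>2)"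
  by (simp add: L2_set_def sum_nonneg)

lemma L2_set_minus_le: "L2_set (\<lambda>x. f x - g x) S \<le> L2_set f S + L2_set g S"
  using L2_set_triangle_ineq[of f "\<lambda>x. - g x" S] by (simp add: L2_set_def)

section \<open>Directed bonds and the non-backtracking relation\<close>

locale regular_simple_graph =
  fixes n d :: nat and E :: "nat \<Rightarrow> nat \<Rightarrow> bool"
  assumes simple: "simple_graph n E" and reg: "regular n E d" and deg: "d > 3"
begin

abbreviation D where "D \<equiv> dbonds n E"

lemma edge: "E u v \<Longrightarrow> u < n \<and> v < n \<and> u \<noteq> v \<and> E v u"
  using simple by (auto simp: simple_graph_def)

lemma D_iff: "(u, v) \<in> D \<longleftrightarrow> E u v"
  using edge by (auto simp: dbonds_def)

lemma D_edge: "b \<in> D \<Longrightarrow> E (fst b) (snd b)"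
  using D_iff[of "fst b" "snd b"] by simp

lemma D_Sigma: "D = Sigma {..<n} (nbrs E)"
  using edge by (auto simp: dbonds_def nbrs_def)

lemma finite_nbrs [simp]: "finite (nbrs E v)"
  by (rule finite_subset[of _ "{..<n}"]) (use edge in \<open>auto simp: nbrs_def\<close>)

lemma finite_D [simp]: "finite D"
  by (simp add: D_Sigma)

lemma card_nbrs: "v < n \<Longrightarrow> card (nbrs E v) = d"
  using reg by (simp add: regular_def)

lemma sum_D: "(\<Sum>b\<in>D. h b) = (\<Sum>v<n. \<Sum>w\<in>nbrs E v. h (v, w))"
  by (simp add: D_Sigma sum.Sigma)

lemma sum_D_swap: "(\<Sum>b\<in>D. h (prod.swap b)) = (\<Sum>b\<in>D. h b)"
  by (rule sum.reindex_bij_witness[of _ prod.swap prod.swap]) (auto simp: D_iff edge)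

lemma sum_D_swapped: "(\<Sum>b\<in>D. h b) = (\<Sum>v<n. \<Sum>w\<in>nbrs E v. h (w, v))"
  using sum_D_swap[of h] by (simp add: sum_D[of "\<lambda>b. h (prod.swap b)"])

text \<open>Inside \<open>D\<close> this is the support of the bond scattering matrix, since
  equi-transmission forbids reflection into the reversed bond.\<close>

definition nb :: "nat \<times> nat \<Rightarrow> nat \<times> nat \<Rightarrow> bool" where
  "nb b c \<longleftrightarrow> snd b = fst c \<and> fst b \<noteq> snd c"

lemma nb_successors: "b \<in> D \<Longrightarrow> {c \<in> D. nb b c} = Pair (snd b) ` (nbrs E (snd b) - {fst b})"
  by (auto simp: nb_def D_iff nbrs_def)

lemma nb_predecessors: "c \<in> D \<Longrightarrow> {b \<in> D. nb b c} = (\<lambda>u. (u, fst c)) ` (nbrs E (fst c) - {snd c})"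
  using edge by (auto simp: nb_def D_iff nbrs_def image_iff)

lemma card_nb_successors: "b \<in> D \<Longrightarrow> card {c \<in> D. nb b c} = d - 1"
  using edge[of "fst b" "snd b"] D_iff[of "fst b" "snd b"] card_nbrs[of "snd b"]
  by (simp add: nb_successors card_image inj_on_def nbrs_def card_Diff_singleton)

lemma card_nb_predecessors: "c \<in> D \<Longrightarrow> card {b \<in> D. nb b c} = d - 1"
  using edge[of "fst c" "snd c"] D_iff[of "fst c" "snd c"] card_nbrs[of "fst c"]
  by (simp add: nb_predecessors card_image inj_on_def nbrs_def card_Diff_singleton)

lemma sum_nb_successors: "(\<Sum>b\<in>D. \<Sum>c | c \<in> D \<and> nb b c. h c) = (d - 1) * (\<Sum>c\<in>D. h c :: real)"
proof -
  have "(\<Sum>b\<in>D. \<Sum>c | c \<in> D \<and> nb b c. h c) = (\<Sum>c\<in>D. \<Sum>b | b \<in> D \<and> nb b c. h c)"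
    by (rule sum.swap_restrict) simp_all
  also have "\<dots> = (\<Sum>c\<in>D. (d - 1) * h c)"
    by (intro sum.cong refl) (simp add: card_nb_predecessors)
  finally show ?thesis
    by (simp add: sum_distrib_left)
qed

section \<open>The Markov operator and its vertex sums\<close>

text \<open>The matrix of squared moduli of the entries of \<open>U\<close>, acting on functions on
  \<open>D\<close>; see \<open>Umat_modulus\<close>.\<close>

definition mstep :: "(nat \<times> nat \<Rightarrow> real) \<Rightarrow> nat \<times> nat \<Rightarrow> real" where
  "mstep g b = (\<Sum>c | c \<in> D \<and> nb b c. g c) / (d - 1)"

lemma sum_mstep: "(\<Sum>b\<in>D. mstep g b) = (\<Sum>b\<in>D. g b)"
  using deg by (simp add: mstep_def sum_nb_successors flip: sum_divide_distrib)

text \<open>Cauchy-Schwarz over the \<open>d - 1\<close> successors of each bond; every bond is in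
  turn a successor of exactly \<open>d - 1\<close> bonds.\<close>

lemma L2_set_mstep_le: "L2_set (mstep g) D \<le> L2_set g D"
proof -
  have "(\<Sum>b\<in>D. (mstep g b)\<^sup>2) \<le> (\<Sum>b\<in>D. (\<Sum>c | c \<in> D \<and> nb b c. (g c)\<^sup>2) / (d - 1))"
  proof (intro sum_mono)
    fix b assume "b \<in> D"
    then have "(\<Sum>c | c \<in> D \<and> nb b c. g c)\<^sup>2 \<le> real (d - 1) * (\<Sum>c | c \<in> D \<and> nb b c. (g c)\<^sup>2)"
      using sum_sq_le_card[of g "{c \<in> D. nb b c}"] by (simp add: card_nb_successors)
    then show "(mstep g b)\<^sup>2 \<le> (\<Sum>c | c \<in> D \<and> nb b c. (g c)\<^sup>2) / (d - 1)"
      using deg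
      by (simp add: mstep_def power_divide power2_eq_square divide_le_eq mult.commute del: of_nat_diff)
  qed
  also have "\<dots> = (\<Sum>b\<in>D. (g b)\<^sup>2)"
    using deg by (simp add: sum_nb_successors flip: sum_divide_distrib)
  finally show ?thesis
    by (simp add: L2_set_def)
qed

definition outs :: "(nat \<times> nat \<Rightarrow> real) \<Rightarrow> nat \<Rightarrow> real" where
  "outs g v = (\<Sum>w\<in>nbrs E v. g (v, w))"

definition ins :: "(nat \<times> nat \<Rightarrow> real) \<Rightarrow> nat \<Rightarrow> real" where
  "ins g v = (\<Sum>w\<in>nbrs E v. g (w, v))"

definition adj :: "(nat \<Rightarrow> real) \<Rightarrow> nat \<Rightarrow> real" where
  "adj a v = (\<Sum>w\<in>nbrs E v. a w)"

text \<open>The successors of \<open>b\<close> are all bonds leaving its endpoint except the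
  reversal of \<open>b\<close>. This ties the walk on bonds to sums at vertices.\<close>

lemma mstep_outs:
  assumes "b \<in> D"
  shows "(real d - 1) * mstep g b = outs g (snd b) - g (prod.swap b)"
proof -
  have b: "fst b \<in> nbrs E (snd b)"
    using assms edge D_iff[of "fst b" "snd b"] by (simp add: nbrs_def)
  have "(\<Sum>c | c \<in> D \<and> nb b c. g c) = (\<Sum>w\<in>nbrs E (snd b) - {fst b}. g (snd b, w))"
    using assms by (simp add: nb_successors sum.reindex inj_on_def)
  also have "\<dots> = outs g (snd b) - g (snd b, fst b)"
    using b by (simp add: sum_diff1 outs_def)
  finally show ?thesis
    using deg by (simp add: mstep_def of_nat_diff prod.swap_def)
qed

lemma outs_mstep:
  assumes "v < n"
  shows "(real d - 1) * outs (mstep g) v = adj (outs g) v - ins g v"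
proof -
  have "(real d - 1) * outs (mstep g) v = (\<Sum>w\<in>nbrs E v. (real d - 1) * mstep g (v, w))"
    by (simp add: outs_def sum_distrib_left)
  also have "\<dots> = (\<Sum>w\<in>nbrs E v. outs g w - g (w, v))"
    by (intro sum.cong refl, subst mstep_outs) (auto simp: D_iff nbrs_def)
  finally show ?thesis
    by (simp add: sum_subtractf adj_def ins_def)
qed

text \<open>Over the bonds arriving at \<open>v\<close>, the term \<open>outs g v\<close> occurs
  \<open>d\<close> times, and the excluded reversals add up to one \<open>outs g v\<close>.\<close>

lemma ins_mstep:
  assumes "v < n"
  shows "ins (mstep g) v = outs g v"
proof -
  have "(real d - 1) * ins (mstep g) v = (\<Sum>w\<in>nbrs E v. (real d - 1) * mstep g (w, v))"
    by (simp add: ins_def sum_distrib_left)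
  also have "\<dots> = (\<Sum>w\<in>nbrs E v. outs g v - g (v, w))"
    by (intro sum.cong refl, subst mstep_outs) (use edge in \<open>auto simp: D_iff nbrs_def\<close>)
  also have "\<dots> = (real d - 1) * outs g v"
    using assms by (simp add: sum_subtractf card_nbrs outs_def[symmetric] algebra_simps)
  finally show ?thesis
    using deg by simp
qed

lemma L2_set_outs_le: "L2_set (outs g) {..<n} \<le> sqrt d * L2_set g D"
proof -
  have "(\<Sum>v<n. (outs g v)\<^sup>2) \<le> (\<Sum>v<n. d * (\<Sum>w\<in>nbrs E v. (g (v, w))\<^sup>2))"
    unfolding outs_def by (intro sum_mono order_trans[OF sum_sq_le_card]) (simp add: card_nbrs)
  then show ?thesis
    by (simp add: L2_set_def sum_D flip: real_sqrt_mult sum_distrib_left)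
qed

lemma L2_set_ins_le: "L2_set (ins g) {..<n} \<le> sqrt d * L2_set g D"
proof -
  have "(\<Sum>v<n. (ins g v)\<^sup>2) \<le> (\<Sum>v<n. d * (\<Sum>w\<in>nbrs E v. (g (w, v))\<^sup>2))"
    unfolding ins_def by (intro sum_mono order_trans[OF sum_sq_le_card]) (simp add: card_nbrs)
  then show ?thesis
    by (simp add: L2_set_def sum_D_swapped flip: real_sqrt_mult sum_distrib_left)
qed

lemma L2_set_snd: "L2_set (\<lambda>b. a (snd b)) D = sqrt d * L2_set a {..<n}"
  by (simp add: L2_set_def sum_D_swapped card_nbrs flip: real_sqrt_mult sum_distrib_left)

section \<open>Spectral gap and the resolvent of the walk\<close>

text \<open>A Poincare inequality for the graph Laplacian \<open>d - C\<close> on functions of mean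
  zero. The bound \<open>\<beta> \<le> d\<close> lets constants be absorbed into multiples of
  \<open>1 / \<beta>\<close>.\<close>

definition spectral_gap :: "real \<Rightarrow> bool" where
  "spectral_gap \<beta> \<longleftrightarrow> 0 < \<beta> \<and> \<beta> \<le> real d \<and>
    (\<forall>a::nat \<Rightarrow> real. (\<Sum>v<n. a v) = 0 \<longrightarrow> \<beta> * (\<Sum>v<n. (a v)\<^sup>2) \<le> (\<Sum>v<n. a v * (d * a v - adj a v)))"

lemma L2_set_le_resolvent:
  assumes gap: "spectral_gap \<beta>" and sum0: "(\<Sum>b\<in>D. g b) = 0"
  shows "L2_set g D \<le> 2 * d\<^sup>2 / \<beta> * L2_set (\<lambda>b. g b - mstep g b) D"
proof -
  define h where "h b = g b - mstep g b" for b
  define a where "a = outs g"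
  have \<beta>: "0 < \<beta>" "\<beta> \<le> d"
    using gap by (auto simp: spectral_gap_def)
  \<comment> \<open>In this combination the two contributions of \<open>ins g\<close> cancel: one
    enters through \<open>outs_mstep\<close>, the other through \<open>ins h\<close>.\<close>
  have res: "d * a v - adj a v = (real d - 1) * outs h v - ins h v" if "v < n" for v
  proof -
    have 1: "outs h v = outs g v - outs (mstep g) v" "ins h v = ins g v - ins (mstep g) v"
      by (simp_all add: outs_def ins_def h_def sum_subtractf)
    show ?thesis
      using outs_mstep[OF that, of g] ins_mstep[OF that, of g] unfolding 1 a_def
      by (simp add: algebra_simps)
  qed
  have "(\<Sum>v<n. a v) = 0"
    using sum0 by (simp add: a_def outs_def sum_D)
  then have "\<beta> * (L2_set a {..<n})\<^sup>2 \<le> (\<Sum>v<n. a v * (d * a v - adj a v))"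
    using gap by (simp add: spectral_gap_def L2_set_sq)
  also have "\<dots> = (\<Sum>v<n. a v * ((real d - 1) * outs h v - ins h v))"
    by (intro sum.cong refl) (simp add: res)
  also have "\<dots> \<le> L2_set a {..<n} * L2_set (\<lambda>v. (real d - 1) * outs h v - ins h v) {..<n}"
    by (rule sum_mult_le_L2_set)
  also have "\<dots> \<le> L2_set a {..<n} * (d * sqrt d * L2_set h D)"
  proof (intro mult_left_mono L2_set_nonneg)
    have "L2_set (\<lambda>v. (real d - 1) * outs h v - ins h v) {..<n}
        \<le> (real d - 1) * L2_set (outs h) {..<n} + L2_set (ins h) {..<n}"
      using L2_set_minus_le[of "\<lambda>v. (real d - 1) * outs h v" "ins h" "{..<n}"] deg
      by (simp add: L2_set_right_distrib)
    also have "\<dots> \<le> (real d - 1) * (sqrt d * L2_set h D) + sqrt d * L2_set h D"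
      using deg by (intro add_mono mult_left_mono L2_set_outs_le L2_set_ins_le) auto
    finally show "L2_set (\<lambda>v. (real d - 1) * outs h v - ins h v) {..<n} \<le> d * sqrt d * L2_set h D"
      by (simp add: algebra_simps)
  qed
  finally have "\<beta> * L2_set a {..<n} \<le> d * sqrt d * L2_set h D"
    by (cases "L2_set a {..<n} = 0")
      (auto simp: power2_eq_square L2_set_nonneg less_le mult.left_commute)
  then have "sqrt d * (\<beta> * L2_set a {..<n}) \<le> sqrt d * (d * sqrt d * L2_set h D)"
    by (rule mult_left_mono) simp
  also have "\<dots> = d\<^sup>2 * L2_set h D"
    by (simp add: power2_eq_square)
  finally have a_le: "sqrt d * L2_set a {..<n} \<le> d\<^sup>2 / \<beta> * L2_set h D"
    using \<beta> by (simp add: le_divide_eq mult_ac)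
  have "(real d - 1) * L2_set g D = L2_set (\<lambda>b. (real d - 1) * g b) D"
    using deg by (simp add: L2_set_right_distrib)
  \<comment> \<open>\<open>mstep_outs\<close> solved for \<open>g\<close>, with
    \<open>mstep g = g - h\<close>.\<close>
  also have "\<dots> = L2_set (\<lambda>b. ((real d - 1) * h b + a (snd b)) - g (prod.swap b)) D"
    by (rule L2_set_cong) (use mstep_outs[of _ g] in \<open>auto simp: h_def a_def algebra_simps\<close>)
  also have "\<dots> \<le> L2_set (\<lambda>b. (real d - 1) * h b + a (snd b)) D + L2_set (\<lambda>b. g (prod.swap b)) D"
    by (rule L2_set_minus_le)
  also have "\<dots> \<le> (L2_set (\<lambda>b. (real d - 1) * h b) D + L2_set (\<lambda>b. a (snd b)) D) + L2_set (\<lambda>b. g (prod.swap b)) D"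
    by (intro add_mono L2_set_triangle_ineq order_refl)
  also have "L2_set (\<lambda>b. (real d - 1) * h b) D = (real d - 1) * L2_set h D"
    using deg by (simp add: L2_set_right_distrib)
  also have "L2_set (\<lambda>b. g (prod.swap b)) D = L2_set g D"
    using sum_D_swap[of "\<lambda>b. (g b)\<^sup>2"] by (simp add: L2_set_def)
  \<comment> \<open>Reversal preserves the norm, so moving that term to the left turns
    \<open>d - 1\<close> into \<open>d - 2\<close>, which is still at least 1.\<close>
  finally have "(real d - 2) * L2_set g D \<le> (real d - 1) * L2_set h D + d\<^sup>2 / \<beta> * L2_set h D"
    using a_le by (simp add: L2_set_snd algebra_simps)
  also have "(real d - 1) * L2_set h D \<le> d\<^sup>2 / \<beta> * L2_set h D"
  proof (intro mult_right_mono L2_set_nonneg)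
    have "(real d - 1) * \<beta> \<le> real d * real d"
      using \<beta> by (intro mult_mono) auto
    then show "real d - 1 \<le> d\<^sup>2 / \<beta>"
      using \<beta> by (simp add: pos_le_divide_eq power2_eq_square)
  qed
  finally have "(real d - 2) * L2_set g D \<le> 2 * d\<^sup>2 / \<beta> * L2_set h D"
    by (simp add: mult_ac)
  moreover have "1 * L2_set g D \<le> (real d - 2) * L2_set g D"
    using deg by (intro mult_right_mono L2_set_nonneg) auto
  ultimately show ?thesis
    by (simp add: h_def[abs_def])
qed

lemma sum_mstep_pow: "(\<Sum>b\<in>D. (mstep ^^ t) g b) = (\<Sum>b\<in>D. g b)"
  by (induction t) (simp_all add: sum_mstep)

lemma L2_set_mstep_pow_le: "L2_set ((mstep ^^ t) g) D \<le> L2_set g D"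
  by (induction t) (auto intro: order_trans[OF L2_set_mstep_le])

lemma mstep_sum_family: "mstep (\<lambda>b. \<Sum>t\<in>S. h t b) b = (\<Sum>t\<in>S. mstep (h t) b)"
  unfolding mstep_def by (subst sum.swap) (simp add: sum_divide_distrib)

text \<open>The times are summed before any estimate: Cauchy-Schwarz is applied once, to
  \<open>g\<close> against the partial sum \<open>G\<close>, whose resolvent bound is uniform in
  \<open>s\<close>.\<close>

lemma correlation_sum_le:
  assumes gap: "spectral_gap \<beta>" and sum0: "(\<Sum>b\<in>D. g b) = 0"
  shows "(\<Sum>t\<le>s. \<Sum>b\<in>D. g b * (mstep ^^ t) g b) \<le> 4 * d\<^sup>2 / \<beta> * (\<Sum>b\<in>D. (g b)\<^sup>2)"
proof -
  define G where "G b = (\<Sum>t\<le>s. (mstep ^^ t) g b)" for b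
  have \<beta>: "0 < \<beta>"
    using gap by (auto simp: spectral_gap_def)
  have G0: "(\<Sum>b\<in>D. G b) = 0"
    unfolding G_def by (subst sum.swap) (simp add: sum_mstep_pow sum0)
  have tel: "G b - mstep G b = g b - (mstep ^^ Suc s) g b" for b
  proof -
    have "mstep G b = (\<Sum>t\<le>s. (mstep ^^ Suc t) g b)"
      unfolding G_def by (simp add: mstep_sum_family)
    then have "G b - mstep G b = (\<Sum>t\<le>s. (mstep ^^ t) g b - (mstep ^^ Suc t) g b)"
      by (simp add: G_def sum_subtractf)
    also have "\<dots> = g b - (mstep ^^ Suc s) g b"
      by (subst sum_telescope) simp
    finally show ?thesis .
  qed
  have "L2_set G D \<le> 2 * d\<^sup>2 / \<beta> * L2_set (\<lambda>b. g b - (mstep ^^ Suc s) g b) D"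
    using L2_set_le_resolvent[OF gap G0] by (simp only: tel)
  \<comment> \<open>The telescoped sum leaves two terms of norm at most that of \<open>g\<close>,
    which doubles the constant 2.\<close>
  also have "\<dots> \<le> 2 * d\<^sup>2 / \<beta> * (L2_set g D + L2_set g D)"
    using \<beta> by (intro mult_left_mono order_trans[OF L2_set_minus_le] add_mono L2_set_mstep_pow_le) auto
  finally have G_le: "L2_set G D \<le> 4 * d\<^sup>2 / \<beta> * L2_set g D"
    by simp
  have "(\<Sum>t\<le>s. \<Sum>b\<in>D. g b * (mstep ^^ t) g b) = (\<Sum>b\<in>D. g b * G b)"
    unfolding G_def by (subst sum.swap) (simp add: sum_distrib_left)
  also have "\<dots> \<le> L2_set g D * L2_set G D"
    by (rule sum_mult_le_L2_set)
  also have "\<dots> \<le> L2_set g D * (4 * d\<^sup>2 / \<beta> * L2_set g D)"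
    by (intro mult_left_mono G_le L2_set_nonneg)
  finally show ?thesis
    using L2_set_sq[of g D] by (simp add: power2_eq_square mult_ac)
qed

section \<open>From eigenvalues of the connectivity matrix to the spectral gap\<close>

lemma sum_mult_adj:
  fixes x y :: "nat \<Rightarrow> real"
  shows "(\<Sum>v<n. x v * adj y v) = (\<Sum>b\<in>D. x (fst b) * y (snd b))"
  by (simp add: sum_D adj_def sum_distrib_left)

lemma adj_symmetric:
  fixes x y :: "nat \<Rightarrow> real"
  shows "(\<Sum>v<n. x v * adj y v) = (\<Sum>v<n. y v * adj x v)"
  unfolding sum_mult_adj using sum_D_swap[of "\<lambda>b. y (fst b) * x (snd b)"] by (simp add: mult.commute)

text \<open>Expanding the square, each of the two pure terms sums to \<open>d\<close> times the
  squared norm by regularity. If the form vanishes, \<open>x\<close> is constant along bonds, which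
  later excludes the eigenvalue \<open>d\<close>.\<close>

lemma dirichlet_form:
  fixes x :: "nat \<Rightarrow> real"
  shows "(\<Sum>b\<in>D. (x (fst b) - x (snd b))\<^sup>2) = 2 * (d * (\<Sum>v<n. (x v)\<^sup>2) - (\<Sum>v<n. x v * adj x v))"
proof -
  have "(\<Sum>b\<in>D. (x (fst b))\<^sup>2) = d * (\<Sum>v<n. (x v)\<^sup>2)"
    by (simp add: sum_D card_nbrs sum_distrib_left)
  moreover have "(\<Sum>b\<in>D. (x (snd b))\<^sup>2) = d * (\<Sum>v<n. (x v)\<^sup>2)"
    by (simp add: sum_D_swapped card_nbrs sum_distrib_left)
  moreover have "(\<Sum>b\<in>D. (x (fst b) - x (snd b))\<^sup>2)
      = (\<Sum>b\<in>D. (x (fst b))\<^sup>2) + (\<Sum>b\<in>D. (x (snd b))\<^sup>2) - 2 * (\<Sum>b\<in>D. x (fst b) * x (snd b))"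
    unfolding power2_diff by (simp add: sum.distrib sum_subtractf sum_distrib_left mult.assoc)
  ultimately show ?thesis
    by (simp add: sum_mult_adj)
qed

lemma sum_adj:
  fixes x :: "nat \<Rightarrow> real"
  shows "(\<Sum>v<n. adj x v) = d * (\<Sum>v<n. x v)"
  using adj_symmetric[of "\<lambda>_. 1" x] by (simp add: adj_def card_nbrs sum_distrib_left mult.commute)

lemma conn_eigenvalueI:
  assumes "i < n" "x i \<noteq> 0" "\<And>v. v < n \<Longrightarrow> adj x v = \<mu> * x v"
  shows "conn_eigenvalue n E \<mu>"
proof -
  have "(\<Sum>j<n. (if E v j then 1 else 0) * x j) = \<mu> * x v" if "v < n" for v
  proof -
    have "(\<Sum>j<n. (if E v j then 1 else 0) * x j) = (\<Sum>j\<in>nbrs E v. x j)"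
      by (rule sum.mono_neutral_cong_right) (use edge in \<open>auto simp: nbrs_def\<close>)
    then show ?thesis
      using assms(3)[OF that] by (simp add: adj_def)
  qed
  then show ?thesis
    unfolding conn_eigenvalue_def using assms(1,2) by blast
qed

text \<open>Compactness of the unit sphere of mean-zero vectors gives a maximiser of the quadratic
  form; homogeneity extends the inequality to all \<open>y\<close> of mean zero.\<close>

lemma rayleigh_maximiser:
  assumes "n \<ge> 2"
  obtains x :: "nat \<Rightarrow> real" where "(\<Sum>v<n. (x v)\<^sup>2) = 1" "(\<Sum>v<n. x v) = 0"
    "\<And>y. (\<Sum>v<n. y v) = 0 \<Longrightarrow> (\<Sum>v<n. y v * adj y v) \<le> (\<Sum>v<n. x v * adj x v) * (\<Sum>v<n. (y v)\<^sup>2)"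
proof -
  define F where "F x = (\<Sum>v<n. x v * adj x v)" for x
  \<comment> \<open>Vectors are functions on \<open>nat\<close>; confining them to
    \<open>[-1, 1]\<close> below \<open>n\<close> and to 0 from \<open>n\<close> on gives a compact
    set by Tychonoff's theorem.\<close>
  define S where "S i = (if i < n then {-1..1} else {0::real})" for i
  define X where "X = Pi\<^sub>E UNIV S \<inter> {x. (\<Sum>v<n. (x v)\<^sup>2) = 1} \<inter> {x. (\<Sum>v<n. x v) = 0}"
  have "compact (Pi\<^sub>E UNIV S)"
    unfolding compactin_euclidean_iff[symmetric] euclidean_product_topology[symmetric] compactin_PiE
    by (simp add: S_def)
  moreover have "closed {x::nat \<Rightarrow> real. (\<Sum>v<n. (x v)\<^sup>2) = 1}" "closed {x::nat \<Rightarrow> real. (\<Sum>v<n. x v) = 0}"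
    by (intro closed_Collect_eq continuous_intros; simp)+
  ultimately have "compact X"
    unfolding X_def by (intro compact_Int_closed)
  moreover have "X \<noteq> {}"
  proof -
    define z :: "nat \<Rightarrow> real" where "z i = (if i = 0 then 1 / sqrt 2 else if i = 1 then - 1 / sqrt 2 else 0)" for i
    have n: "{..<n} = insert 0 (insert 1 {2..<n})"
      using assms by auto
    have "0 \<le> 1 / sqrt 2"
      by simp
    then have "- 1 \<le> 1 / sqrt 2"
      by linarith
    then have "z \<in> X"
      using assms by (auto simp: X_def S_def z_def n power_divide divide_le_eq_1)
    then show ?thesis
      by blast
  qed
  moreover have "continuous_on X F"
    unfolding F_def adj_def
    by (intro continuous_intros continuous_on_subset[OF continuous_on_product_coordinates]) auto
  ultimately obtain x where x: "x \<in> X" "\<And>y. y \<in> X \<Longrightarrow> F y \<le> F x"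
    using continuous_attains_sup by metis
  have "F y \<le> F x * (\<Sum>v<n. (y v)\<^sup>2)" if y: "(\<Sum>v<n. y v) = 0" for y
  proof (cases "(\<Sum>v<n. (y v)\<^sup>2) = 0")
    case True
    then have "\<forall>v<n. y v = 0"
      by (subst (asm) sum_nonneg_eq_0_iff) auto
    then show ?thesis
      by (simp add: F_def)
  next
    case False
    define r where "r = sqrt (\<Sum>v<n. (y v)\<^sup>2)"
    have r2: "r\<^sup>2 = (\<Sum>v<n. (y v)\<^sup>2)"
      by (simp add: r_def sum_nonneg)
    have r: "r > 0"
      using False by (simp add: r_def less_le sum_nonneg)
    \<comment> \<open>Normalised, and cut off from \<open>n\<close> on to land in \<open>X\<close>;
      the form sees only indices below \<open>n\<close>, as edges stay there.\<close>
    define z where "z v = (if v < n then y v / r else 0)" for v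
    have z1: "(\<Sum>v<n. (z v)\<^sup>2) = 1"
      using r False r2 by (simp add: z_def power_divide flip: sum_divide_distrib)
    have "\<bar>z v\<bar> \<le> 1" if "v < n" for v
    proof -
      have "(z v)\<^sup>2 \<le> (\<Sum>v<n. (z v)\<^sup>2)"
        using that by (intro member_le_sum) auto
      then show ?thesis
        by (simp add: z1 abs_square_le_1)
    qed
    then have "z \<in> Pi\<^sub>E UNIV S"
      by (auto simp: S_def abs_le_iff minus_le_iff) (simp add: z_def)
    moreover have "(\<Sum>v<n. z v) = 0"
      using y by (simp add: z_def flip: sum_divide_distrib)
    ultimately have "z \<in> X"
      using z1 by (simp add: X_def)
    moreover have "F z = F y / r\<^sup>2"
    proof -
      have "adj z v = adj y v / r" for v
        unfolding adj_def sum_divide_distrib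
        by (intro sum.cong refl) (use edge in \<open>auto simp: z_def nbrs_def\<close>)
      then show ?thesis
        by (simp add: F_def z_def power2_eq_square sum_divide_distrib)
    qed
    ultimately have "F y / r\<^sup>2 \<le> F x"
      using x(2) by metis
    then show ?thesis
      using r by (simp add: r2 [symmetric] divide_le_eq)
  qed
  then show ?thesis
    using that[of x] x(1) by (auto simp: X_def F_def)
qed

text \<open>The Rayleigh maximum \<open>m\<close> on mean-zero vectors is an eigenvalue by the first
  variation, and connectedness makes it differ from \<open>d\<close>, so \<open>ev\<close> applies
  to it.\<close>

lemma spectral_gap_of_eigenvalues:
  assumes conn: "connected_graph n E" and "\<beta> > 0"
    and ev: "\<And>\<mu>. conn_eigenvalue n E \<mu> \<Longrightarrow> \<mu> \<noteq> real d \<Longrightarrow> \<bar>\<mu>\<bar> \<le> real d - \<beta>"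
  shows "spectral_gap \<beta>"
proof -
  have "n > 0"
    using conn by (simp add: connected_graph_def)
  then have "nbrs E 0 \<noteq> {}"
    using card_nbrs[of 0] deg by auto
  then have n2: "n \<ge> 2"
    using edge by (fastforce simp: nbrs_def)
  obtain x where x1: "(\<Sum>v<n. (x v)\<^sup>2) = 1" and x0: "(\<Sum>v<n. x v) = 0"
    and max: "\<And>y. (\<Sum>v<n. y v) = 0 \<Longrightarrow> (\<Sum>v<n. y v * adj y v) \<le> (\<Sum>v<n. x v * adj x v) * (\<Sum>v<n. (y v)\<^sup>2)"
    using rayleigh_maximiser[OF n2] by blast
  define m where "m = (\<Sum>v<n. x v * adj x v)"
  define Q where "Q y = m * (\<Sum>v<n. (y v)\<^sup>2) - (\<Sum>v<n. y v * adj y v)" for y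
  have Q_nonneg: "Q y \<ge> 0" if "(\<Sum>v<n. y v) = 0" for y
    using max[OF that] by (simp add: Q_def m_def)
  obtain i where i: "i < n" "x i \<noteq> 0"
    using x1 by (metis (no_types, lifting) lessThan_iff power_zero_numeral sum.neutral zero_neq_one)
  \<comment> \<open>The gradient direction: \<open>Y = 0\<close> says that \<open>x\<close> is an
    eigenvector. It has mean zero because \<open>C\<close> multiplies the total sum by
    \<open>d\<close>.\<close>
  define y where "y v = m * x v - adj x v" for v
  have y0: "(\<Sum>v<n. y v) = 0"
    using sum_adj[of x] by (simp add: y_def sum_subtractf x0 flip: sum_distrib_left)
  define Y where "Y = (\<Sum>v<n. (y v)\<^sup>2)"
  \<comment> \<open>There is no constant term: \<open>Q x = 0\<close>, since \<open>x\<close> is a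
    unit vector on which the form takes the value \<open>m\<close>.\<close>
  have expand: "Q (\<lambda>v. x v + e * y v) = 2 * e * Y + e\<^sup>2 * Q y" for e
  proof -
    have adj_lin: "adj (\<lambda>v. x v + e * y v) v = adj x v + e * adj y v" for v
      by (simp add: adj_def sum.distrib sum_distrib_left)
    have Y: "Y = m * (\<Sum>v<n. x v * y v) - (\<Sum>v<n. y v * adj x v)"
      by (simp add: Y_def sum_distrib_left power2_eq_square flip: sum_subtractf)
        (simp add: y_def algebra_simps)
    have "Q (\<lambda>v. x v + e * y v)
        = m * (\<Sum>v<n. (x v)\<^sup>2) + 2 * e * (m * (\<Sum>v<n. x v * y v)) + e\<^sup>2 * (m * (\<Sum>v<n. (y v)\<^sup>2))
          - (\<Sum>v<n. x v * adj x v) - e * (\<Sum>v<n. y v * adj x v) - e * (\<Sum>v<n. x v * adj y v)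
          - e\<^sup>2 * (\<Sum>v<n. y v * adj y v)"
      unfolding Q_def adj_lin
      by (simp add: sum_distrib_left power2_eq_square algebra_simps sum.distrib sum_subtractf)
    then show ?thesis
      unfolding adj_symmetric[of x y] x1 m_def[symmetric] Y Q_def[of y] by (simp add: algebra_simps)
  qed
  have "Y \<le> 0"
  proof (rule ccontr)
    assume "\<not> Y \<le> 0"
    \<comment> \<open>A negative step so short that the linear term wins: \<open>2 Y + e Q y\<close>
      stays positive, against \<open>Q \<ge> 0\<close>.\<close>
    define e where "e = - Y / (Q y + 1)"
    have "0 \<le> Q (\<lambda>v. x v + e * y v)"
      by (rule Q_nonneg) (simp add: sum.distrib x0 y0 flip: sum_distrib_left)
    then have "0 \<le> e * (2 * Y + e * Q y)"
      by (simp add: expand power2_eq_square algebra_simps)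
    moreover have "e < 0" "2 * Y + e * Q y > 0"
      using \<open>\<not> Y \<le> 0\<close> Q_nonneg[OF y0]
      by (auto simp: e_def field_simps intro!: add_nonneg_pos)
    ultimately show False
      using mult_neg_pos by fastforce
  qed
  then have "\<forall>v<n. y v = 0"
    using sum_nonneg_eq_0_iff[of "{..<n}" "\<lambda>v. (y v)\<^sup>2"] sum_nonneg[of "{..<n}" "\<lambda>v. (y v)\<^sup>2"]
    by (auto simp: Y_def)
  then have "conn_eigenvalue n E m"
    using conn_eigenvalueI[of i x m] i by (simp add: y_def)
  \<comment> \<open>Otherwise the Dirichlet form of \<open>x\<close> vanishes, so \<open>x\<close>
    is constant by connectedness and zero by its mean, contradicting
    \<open>x i \<noteq> 0\<close>.\<close>
  moreover have "m \<noteq> d"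
  proof
    assume "m = d"
    then have "(\<Sum>b\<in>D. (x (fst b) - x (snd b))\<^sup>2) = 0"
      using dirichlet_form[of x] by (simp add: x1 m_def)
    then have "\<forall>b\<in>D. x (fst b) = x (snd b)"
      by (subst (asm) sum_nonneg_eq_0_iff) auto
    then have eq: "x u = x v" if "E u v" for u v
      using that D_iff by force
    have "x v = x i" if "v < n" for v
    proof -
      have "E\<^sup>*\<^sup>* i v"
        using conn i that by (simp add: connected_graph_def)
      then show ?thesis
        by (induction rule: rtranclp_induct) (auto dest: eq)
    qed
    then have "(\<Sum>v<n. x v) = n * x i"
      by simp
    then show False
      using x0 i by auto
  qed
  ultimately have "\<bar>m\<bar> \<le> d - \<beta>"
    using ev by blast
  then have m: "m \<le> d - \<beta>" "\<beta> \<le> d"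
    by linarith+
  have "\<beta> * (\<Sum>v<n. (a v)\<^sup>2) \<le> (\<Sum>v<n. a v * (d * a v - adj a v))" if "(\<Sum>v<n. a v) = 0"
    for a :: "nat \<Rightarrow> real"
  proof -
    have "(\<Sum>v<n. a v * adj a v) \<le> m * (\<Sum>v<n. (a v)\<^sup>2)"
      using max[OF that] by (simp add: m_def)
    also have "\<dots> \<le> (d - \<beta>) * (\<Sum>v<n. (a v)\<^sup>2)"
      by (intro mult_right_mono m sum_nonneg) auto
    finally have "\<beta> * (\<Sum>v<n. (a v)\<^sup>2) \<le> d * (\<Sum>v<n. (a v)\<^sup>2) - (\<Sum>v<n. a v * adj a v)"
      by (simp add: algebra_simps)
    also have "\<dots> = (\<Sum>v<n. a v * (d * a v - adj a v))"
      by (simp add: sum_distrib_left power2_eq_square algebra_simps sum_subtractf)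
    finally show ?thesis .
  qed
  then show ?thesis
    using m(2) \<open>\<beta> > 0\<close> by (simp add: spectral_gap_def)
qed

end

section \<open>Short cycles and the unitary evolution\<close>

lemma sum_sum_power_le:
  fixes x :: real
  assumes "x \<ge> 2"
  shows "(\<Sum>s<T. \<Sum>t\<le>s. x ^ t) \<le> 2 * x ^ T"
proof -
  have "(\<Sum>t\<le>s. x ^ t) \<le> 2 * x ^ s" for s
  proof (induction s)
    case (Suc s)
    have "2 * x ^ s \<le> x * x ^ s"
      using assms by (intro mult_right_mono) auto
    then show ?case
      using Suc by simp
  qed simp
  moreover have "(\<Sum>s<T. x ^ s) \<le> x ^ T"
  proof (induction T)
    case (Suc T)
    have "2 * x ^ T \<le> x * x ^ T"
      using assms by (intro mult_right_mono) auto
    then show ?case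
      using Suc by simp
  qed simp
  ultimately show ?thesis
    using sum_mono[of "{..<T}" "\<lambda>s. \<Sum>t\<le>s. x ^ t" "\<lambda>s. 2 * x ^ s"]
    by (simp flip: sum_distrib_left)
qed

context regular_simple_graph
begin

section \<open>Counting non-backtracking walks\<close>

text \<open>A power of the 0/1 matrix, taken in the natural numbers, counts the walks with
  \<open>t\<close> steps between two bonds.\<close>

definition walks :: "nat \<Rightarrow> nat \<times> nat \<Rightarrow> nat \<times> nat \<Rightarrow> nat" where
  "walks = mpow D (\<lambda>b c. of_bool (nb b c))"

lemma walks_0: "walks 0 b c = of_bool (b = c)"
  by (simp add: walks_def)

lemma walks_Suc: "walks (Suc t) b c = (\<Sum>x | x \<in> D \<and> nb b x. walks t x c)"
proof -
  have "walks (Suc t) b c = (\<Sum>x\<in>D. if nb b x then walks t x c else 0)"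
    unfolding walks_def mpow.simps by (intro sum.cong refl) simp
  also have "\<dots> = (\<Sum>x | x \<in> D \<and> nb b x. walks t x c)"
    by (rule sum.inter_filter[symmetric]) simp
  finally show ?thesis .
qed

lemma mstep_pow_eq_walks:
  assumes "b \<in> D"
  shows "(mstep ^^ t) g b = (\<Sum>c\<in>D. walks t b c / (d - 1) ^ t * g c)"
  using assms
proof (induction t arbitrary: b)
  case 0
  have "(\<Sum>c\<in>D. walks 0 b c / (d - 1) ^ 0 * g c) = (\<Sum>c\<in>D. if b = c then g c else 0)"
    by (intro sum.cong refl) (simp add: walks_0)
  then show ?case
    using 0 by simp
next
  case (Suc t)
  have "(mstep ^^ Suc t) g b = (\<Sum>x | x \<in> D \<and> nb b x. \<Sum>c\<in>D. walks t x c / (d - 1) ^ t * g c) / (d - 1)"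
    by (simp add: mstep_def Suc.IH)
  also have "\<dots> = (\<Sum>c\<in>D. \<Sum>x | x \<in> D \<and> nb b x. walks t x c / (d - 1) ^ t * g c) / (d - 1)"
    by (subst sum.swap) simp
  finally show ?case
    by (simp add: walks_Suc sum_divide_distrib sum_distrib_left mult_ac)
qed

lemma walks_row_sum:
  assumes "b \<in> D"
  shows "(\<Sum>c\<in>D. walks t b c / (d - 1) ^ t) = 1"
proof -
  have "(mstep ^^ t) (\<lambda>_. 1) b = 1"
    using assms
  proof (induction t arbitrary: b)
    case (Suc t)
    then show ?case
      using deg by (simp add: mstep_def card_nb_successors)
  qed simp
  then show ?thesis
    using mstep_pow_eq_walks[OF assms, of t "\<lambda>_. 1"] by simp
qed

text \<open>A single walk contributes a single phase, which drops out of the modulus.\<close>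

lemma cmod_mpow_unique_walk:
  assumes U: "\<And>b c. b \<in> D \<Longrightarrow> c \<in> D \<Longrightarrow> (cmod (U b c))\<^sup>2 = of_bool (nb b c) / (d - 1)"
    and "b \<in> D" "c \<in> D" "walks t b c \<le> 1"
  shows "(cmod (mpow D U t b c))\<^sup>2 = walks t b c / (d - 1) ^ t"
  using assms(2,4)
proof (induction t arbitrary: b)
  case 0
  then show ?case
    by (simp add: walks_0)
next
  case (Suc t)
  let ?S = "{x \<in> D. nb b x}"
  have le1: "walks t x c \<le> 1" if "x \<in> ?S" for x
    using member_le_sum[of x ?S "\<lambda>x. walks t x c"] that Suc.prems by (simp add: walks_Suc)
  have zero: "mpow D U t x c = 0" if "x \<in> ?S" "walks t x c = 0" for x
    using Suc.IH[of x] that by simp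
  have restr: "mpow D U (Suc t) b c = (\<Sum>x\<in>?S. U b x * mpow D U t x c)"
    unfolding mpow.simps
  proof (rule sum.mono_neutral_right)
    show "\<forall>x\<in>D - ?S. U b x * mpow D U t x c = 0"
    proof
      fix x assume "x \<in> D - ?S"
      then have "(cmod (U b x))\<^sup>2 = 0"
        using U[OF Suc.prems(1), of x] by simp
      then show "U b x * mpow D U t x c = 0"
        by simp
    qed
  qed auto
  show ?case
  proof (cases "\<forall>x\<in>?S. walks t x c = 0")
    case True
    then have "mpow D U (Suc t) b c = 0"
      unfolding restr using zero by (intro sum.neutral) simp
    moreover have "walks (Suc t) b c = 0"
      using True by (simp add: walks_Suc)
    ultimately show ?thesis
      by simp
  next
    case False
    then obtain x where x: "x \<in> ?S" "walks t x c \<noteq> 0"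
      by blast
    have split: "walks (Suc t) b c = walks t x c + (\<Sum>y\<in>?S - {x}. walks t y c)"
      unfolding walks_Suc by (rule sum.remove) (use x in auto)
    \<comment> \<open>The counts are natural numbers with sum at most 1, so exactly one first step
      carries a walk.\<close>
    then have w: "walks t x c = 1" and "(\<Sum>y\<in>?S - {x}. walks t y c) = 0"
      using Suc.prems x by linarith+
    then have rest: "\<forall>y\<in>?S - {x}. walks t y c = 0"
      by (subst (asm) sum_eq_0_iff) auto
    have "mpow D U (Suc t) b c = U b x * mpow D U t x c + (\<Sum>y\<in>?S - {x}. U b y * mpow D U t y c)"
      unfolding restr by (rule sum.remove) (use x in auto)
    also have "(\<Sum>y\<in>?S - {x}. U b y * mpow D U t y c) = 0"
      using rest zero by (intro sum.neutral) auto
    finally have "(cmod (mpow D U (Suc t) b c))\<^sup>2 = (cmod (U b x))\<^sup>2 * (cmod (mpow D U t x c))\<^sup>2"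
      by (simp add: norm_mult power_mult_distrib)
    also have "\<dots> = 1 / (d - 1) ^ Suc t"
      using U[OF Suc.prems(1), of x] Suc.IH[of x] x w by simp
    finally show ?thesis
      using split w rest by simp
  qed
qed

text \<open>Bond \<open>i\<close> of the walk is \<open>(p i, p (i + 1))\<close>. With
  \<open>t\<close> steps there are \<open>t + 1\<close> bonds, hence edges for
  \<open>i \<le> t\<close> but turns only for \<open>i < t\<close>; the last bond \<open>c\<close>
  starts at \<open>p t\<close>.\<close>

lemma walk_vertices:
  assumes "b \<in> D" "walks t b c \<noteq> 0"
  obtains p where "p 0 = fst b" "p 1 = snd b" "p t = fst c"
    "\<And>i. i \<le> t \<Longrightarrow> E (p i) (p (Suc i))" "\<And>i. i < t \<Longrightarrow> p i \<noteq> p (i + 2)"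
proof -
  have "\<exists>p. p 0 = fst b \<and> p 1 = snd b \<and> p t = fst c \<and>
      (\<forall>i\<le>t. E (p i) (p (Suc i))) \<and> (\<forall>i<t. p i \<noteq> p (i + 2))"
    using assms
  proof (induction t arbitrary: b)
    case 0
    then have "b = c"
      by (simp add: walks_0)
    then show ?case
      using 0 D_iff[of "fst b" "snd b"]
      by (intro exI[of _ "\<lambda>i. if i = 0 then fst b else snd b"]) simp
  next
    case (Suc t)
    then obtain x where x: "x \<in> D" "nb b x" "walks t x c \<noteq> 0"
      unfolding walks_Suc by (auto elim: sum.not_neutral_contains_not_neutral)
    then obtain p where p: "p 0 = fst x" "p 1 = snd x" "p t = fst c"
      "\<forall>i\<le>t. E (p i) (p (Suc i))" "\<forall>i<t. p i \<noteq> p (i + 2)"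
      using Suc.IH by blast
    have "E (fst b) (snd b)"
      using Suc.prems D_iff[of "fst b" "snd b"] by simp
    then show ?case
      using x(2) p
      by (intro exI[of _ "\<lambda>i. case i of 0 \<Rightarrow> fst b | Suc i \<Rightarrow> p i"])
        (auto simp: nb_def split: nat.split)
  qed
  then show ?thesis
    using that by blast
qed

section \<open>Closing two walks to a short cycle\<close>

text \<open>Follow \<open>p\<close> to the meeting point and return along \<open>q\<close>. Turns
  inside either path are non-backtracking by \<open>nbt\<close>; the two joints, at the meeting
  point and at the start, are covered by \<open>differ\<close>.\<close>

lemma closed_nb_walk_of_two_paths:
  assumes j: "2 \<le> j" and ends: "p 0 = q 0" "p j = q j"
    and edges: "\<And>i. i < j \<Longrightarrow> E (p i) (p (Suc i))" "\<And>i. i < j \<Longrightarrow> E (q i) (q (Suc i))"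
    and nbt: "\<And>i. i + 2 \<le> j \<Longrightarrow> p i \<noteq> p (i + 2)" "\<And>i. i + 2 \<le> j \<Longrightarrow> q i \<noteq> q (i + 2)"
    and differ: "p 1 \<noteq> q 1" "p (j - 1) \<noteq> q (j - 1)"
  defines "r \<equiv> \<lambda>i. if i \<le> j then p i else q (2 * j - i)"
  shows "closed_nb_walk E (map r [0..<2 * j])"
proof -
  have nth: "map r [0..<2 * j] ! (m mod (2 * j)) = r (m mod (2 * j))" for m
    using j by simp
  have edge_r: "E (r i) (r ((i + 1) mod (2 * j)))" if i: "i < 2 * j" for i
  proof -
    consider "i < j" | "j \<le> i" "i + 1 < 2 * j" | "i + 1 = 2 * j"
      using i by linarith
    then show ?thesis
    proof cases
      case 1
      then show ?thesis
        using edges(1)[of i] by (simp add: r_def)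
    next
      case 2
      have "E (q (2 * j - (i + 1))) (q (Suc (2 * j - (i + 1))))"
        using 2 by (intro edges(2)) auto
      moreover have "Suc (2 * j - (i + 1)) = 2 * j - i"
        using 2 by auto
      ultimately have "E (q (2 * j - i)) (q (2 * j - (i + 1)))"
        using edge by metis
      moreover have "r i = q (2 * j - i)"
        using 2 ends by (cases "i = j") (auto simp: r_def)
      ultimately show ?thesis
        using 2 by (simp add: r_def)
    next
      case 3
      have "E (q 0) (q (Suc 0))"
        using j by (intro edges(2)) auto
      moreover have "2 * j - i = 1" "\<not> i \<le> j"
        using 3 j by auto
      ultimately show ?thesis
        using 3 edge ends by (simp add: r_def)
    qed
  qed
  have nb_r: "r ((i + 2) mod (2 * j)) \<noteq> r i" if i: "i < 2 * j" for i
  proof -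
    \<comment> \<open>The second and the fifth case are the two joints, centred at index
      \<open>j\<close> and at index 0; in the fourth the walk has just wrapped round to
      \<open>p 0 = q 0\<close>.\<close>
    consider "i + 2 \<le> j" | "i + 1 = j" | "j \<le> i" "i + 2 < 2 * j" | "i + 2 = 2 * j" | "i + 1 = 2 * j"
      using i by linarith
    then show ?thesis
    proof cases
      case 1
      then have "(i + 2) mod (2 * j) = i + 2"
        using j by simp
      then show ?thesis
        using nbt(1)[of i] 1 by (auto simp: r_def)
    next
      case 2
      show ?thesis
      proof (cases "j = 2")
        case True
        then show ?thesis
          using 2 differ by (auto simp: r_def)
      next
        case False
        then have "(i + 2) mod (2 * j) = j + 1" "2 * j - (j + 1) = j - 1" "i = j - 1"
          using 2 j by auto
        then show ?thesis
          using differ(2) by (auto simp: r_def)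
      qed
    next
      case 3
      have "q (2 * j - (i + 2)) \<noteq> q (2 * j - (i + 2) + 2)"
        using 3 by (intro nbt(2)) auto
      moreover have "2 * j - (i + 2) + 2 = 2 * j - i"
        using 3 by auto
      moreover have "r i = q (2 * j - i)"
        using 3 ends by (cases "i = j") (auto simp: r_def)
      ultimately show ?thesis
        using 3 by (simp add: r_def)
    next
      case 4
      have "q 0 \<noteq> q 2"
        using nbt(2)[of 0] j by (simp add: numeral_2_eq_2)
      moreover have "2 * j - i = 2" "(i + 2) mod (2 * j) = 0"
        using 4 by auto
      moreover have "r i = q (2 * j - i)"
        using 4 j ends by (cases "i = j") (auto simp: r_def)
      ultimately show ?thesis
        using ends by (auto simp: r_def)
    next
      case 5
      have "(i + 2) mod (2 * j) = 1"
      proof -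
        have "i + 2 = 2 * j + 1"
          using 5 by simp
        then have "(i + 2) mod (2 * j) = 1 mod (2 * j)"
          by (simp only: mod_add_self1)
        then show ?thesis
          using j by simp
      qed
      moreover have "2 * j - i = 1" "\<not> i \<le> j"
        using 5 j by auto
      ultimately show ?thesis
        using differ(1) j by (simp add: r_def)
    qed
  qed
  show ?thesis
    unfolding closed_nb_walk_def using edge_r nb_r nth j by simp
qed

text \<open>Let \<open>j\<close> be the first meeting after the start. Then
  \<open>p 1 \<noteq> q 1\<close> gives \<open>2 \<le> j\<close>, minimality separates
  \<open>p (j - 1)\<close> from \<open>q (j - 1)\<close>, and the cycle has length
  \<open>2 j \<le> 2 t \<le> l\<close>.\<close>

lemma two_paths_cycle_bond:
  assumes "p 0 = q 0" "p 1 \<noteq> q 1" "p t = q t" "2 * t \<le> l" "t > 0"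
    and pE: "\<And>i. i \<le> t \<Longrightarrow> E (p i) (p (Suc i))" and pnb: "\<And>i. i < t \<Longrightarrow> p i \<noteq> p (i + 2)"
    and qE: "\<And>i. i \<le> t \<Longrightarrow> E (q i) (q (Suc i))" and qnb: "\<And>i. i < t \<Longrightarrow> q i \<noteq> q (i + 2)"
  shows "{p 0, p 1} \<in> cycle_bonds n E l"
proof -
  define j where "j = (LEAST i. 0 < i \<and> p i = q i)"
  have j: "0 < j" "p j = q j"
    using LeastI[of "\<lambda>i. 0 < i \<and> p i = q i" t] assms by (auto simp: j_def)
  have jt: "j \<le> t"
    using Least_le[of "\<lambda>i. 0 < i \<and> p i = q i" t] assms by (auto simp: j_def)
  have "j \<noteq> 1"
    using j assms(2) by auto
  then have j2: "2 \<le> j"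
    using j by linarith
  have "p (j - 1) \<noteq> q (j - 1)"
    using not_less_Least[of "j - 1" "\<lambda>i. 0 < i \<and> p i = q i"] j2 by (auto simp: j_def[symmetric])
  then have cyc: "closed_nb_walk E (map (\<lambda>i. if i \<le> j then p i else q (2 * j - i)) [0..<2 * j])"
    using j2 jt by (intro closed_nb_walk_of_two_paths assms j pE qE pnb qnb) auto
  have "{p 0, p 1} \<in> ubonds n E"
    unfolding ubonds_def using pE[of 0] D_iff[of "p 0" "p 1"] by auto
  moreover have "{p 0, p 1} = {map (\<lambda>i. if i \<le> j then p i else q (2 * j - i)) [0..<2 * j] ! 0,
      map (\<lambda>i. if i \<le> j then p i else q (2 * j - i)) [0..<2 * j] ! ((0 + 1) mod (2 * j))}"
    using j2 by (simp add: nth_map)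
  ultimately show ?thesis
    unfolding cycle_bonds_def mem_Collect_eq using cyc j2 jt assms(4)
    by (intro conjI exI[of _ "map (\<lambda>i. if i \<le> j then p i else q (2 * j - i)) [0..<2 * j]"] exI[of _ 0]) auto
qed

section \<open>Counting the bonds with several walks\<close>

definition directed_cycle_bonds :: "nat \<Rightarrow> (nat \<times> nat) set" where
  "directed_cycle_bonds l = {b \<in> D. {fst b, snd b} \<in> cycle_bonds n E l}"

definition multi_walk_bonds :: "nat \<Rightarrow> (nat \<times> nat) set" where
  "multi_walk_bonds t = {b \<in> D. \<exists>c\<in>D. walks t b c > 1}"

text \<open>Two different walks from \<open>b\<close> to the same bond either agree in their first step, or they split
  there, and then the parts up to their first meeting close up to a non-backtracking cycle.\<close>

lemma multi_walk_bonds_Suc: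
  assumes "2 * t \<le> l"
  shows "multi_walk_bonds (Suc t) \<subseteq> (\<Union>x\<in>multi_walk_bonds t \<union> directed_cycle_bonds l. {b \<in> D. nb b x})"
proof
  fix b assume "b \<in> multi_walk_bonds (Suc t)"
  then obtain c where b: "b \<in> D" and c: "c \<in> D" and w: "walks (Suc t) b c > 1"
    by (auto simp: multi_walk_bonds_def)
  show "b \<in> (\<Union>x\<in>multi_walk_bonds t \<union> directed_cycle_bonds l. {b \<in> D. nb b x})"
  proof (cases "\<exists>x\<in>D. nb b x \<and> walks t x c > 1")
    case True
    then show ?thesis
      using b c by (auto simp: multi_walk_bonds_def)
  next
    case False
    \<comment> \<open>Each first step now carries at most one walk, so more than one walk means two
      different first steps.\<close>
    define S where "S = {x \<in> {x \<in> D. nb b x}. walks t x c \<noteq> 0}"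
    have finS: "finite S"
      by (simp add: S_def)
    have "walks (Suc t) b c = (\<Sum>x\<in>S. walks t x c)"
      unfolding walks_Suc S_def by (rule sum.mono_neutral_right) auto
    also have "\<dots> = (\<Sum>x\<in>S. 1)"
      using False by (intro sum.cong refl) (force simp: S_def)
    finally have "card S > 1"
      using w by simp
    then obtain x y where xy: "x \<in> S" "y \<in> S" "x \<noteq> y"
      using finS by (metis One_nat_def card_le_Suc0_iff_eq not_less)
    obtain p where p: "p 0 = fst x" "p 1 = snd x" "p t = fst c"
      "\<And>i. i \<le> t \<Longrightarrow> E (p i) (p (Suc i))" "\<And>i. i < t \<Longrightarrow> p i \<noteq> p (i + 2)"
      using walk_vertices[of x t c] xy by (auto simp: S_def)
    obtain q where q: "q 0 = fst y" "q 1 = snd y" "q t = fst c"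
      "\<And>i. i \<le> t \<Longrightarrow> E (q i) (q (Suc i))" "\<And>i. i < t \<Longrightarrow> q i \<noteq> q (i + 2)"
      using walk_vertices[of y t c] xy by (auto simp: S_def)
    have "t \<noteq> 0"
    proof
      assume "t = 0"
      then show False
        using xy by (auto simp: S_def walks_0)
    qed
    moreover have "fst x = fst y"
      using xy by (auto simp: S_def nb_def)
    ultimately have "{p 0, p 1} \<in> cycle_bonds n E l"
      using p q xy(3) assms by (intro two_paths_cycle_bond[of p q t]) (auto simp: prod_eq_iff)
    then have "x \<in> directed_cycle_bonds l"
      using p xy by (simp add: directed_cycle_bonds_def S_def)
    then show ?thesis
      using b xy by (auto simp: S_def)
  qed
qed

lemma card_multi_walk_bonds_le:
  assumes "2 * t \<le> l"
  shows "card (multi_walk_bonds t) \<le> 2 * (d - 1) ^ t * card (directed_cycle_bonds l)"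
proof -
  define P where "P = card (directed_cycle_bonds l)"
  \<comment> \<open>The extra \<open>2 P\<close> makes the induction close: it absorbs the
    \<open>P\<close> added in each step because \<open>2 \<le> d - 1\<close>.\<close>
  have "card (multi_walk_bonds t) + 2 * P \<le> 2 * (d - 1) ^ t * P"
    using assms
  proof (induction t)
    case 0
    have "multi_walk_bonds 0 = {}"
      by (auto simp: multi_walk_bonds_def walks_0)
    then show ?case
      by simp
  next
    case (Suc t)
    let ?Z = "multi_walk_bonds t \<union> directed_cycle_bonds l"
    have ZD: "?Z \<subseteq> D"
      by (auto simp: multi_walk_bonds_def directed_cycle_bonds_def)
    then have finZ: "finite ?Z"
      by (rule finite_subset) simp
    have "card (multi_walk_bonds (Suc t)) \<le> card (\<Union>x\<in>?Z. {b \<in> D. nb b x})"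
      using Suc.prems finZ by (intro card_mono multi_walk_bonds_Suc) auto
    also have "\<dots> \<le> (\<Sum>x\<in>?Z. card {b \<in> D. nb b x})"
      by (rule card_UN_le[OF finZ])
    also have "\<dots> = (\<Sum>x\<in>?Z. d - 1)"
      using ZD by (intro sum.cong refl card_nb_predecessors) auto
    also have "\<dots> = (d - 1) * card ?Z"
      by simp
    also have "\<dots> \<le> (d - 1) * (card (multi_walk_bonds t) + P)"
      unfolding P_def by (intro mult_left_mono card_Un_le) simp
    finally have "card (multi_walk_bonds (Suc t)) + 2 * P \<le> (d - 1) * (card (multi_walk_bonds t) + P) + 2 * P"
      by simp
    also have "\<dots> \<le> (d - 1) * (card (multi_walk_bonds t) + P) + (d - 1) * P"
      using deg by (intro add_left_mono mult_right_mono) auto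
    also have "\<dots> = (d - 1) * (card (multi_walk_bonds t) + 2 * P)"
      by (simp add: distrib_left)
    also have "\<dots> \<le> (d - 1) * (2 * (d - 1) ^ t * P)"
      using Suc by (intro mult_left_mono) auto
    finally show ?case
      by (simp add: mult_ac)
  qed
  then show ?thesis
    by (simp add: P_def)
qed

lemma finite_ubonds: "finite (ubonds n E)" and card_ubonds_le: "card (ubonds n E) \<le> card D"
proof -
  have "ubonds n E = (\<lambda>b. {fst b, snd b}) ` D"
    by (force simp: ubonds_def)
  then show "finite (ubonds n E)" "card (ubonds n E) \<le> card D"
    by (simp_all add: card_image_le)
qed

lemma card_directed_cycle_bonds_le: "card (directed_cycle_bonds l) \<le> 2 * card (cycle_bonds n E l)"
proof -
  let ?C = "cycle_bonds n E l"
  have finC: "finite ?C"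
    by (rule finite_subset[OF _ finite_ubonds]) (auto simp: cycle_bonds_def)
  have pair: "finite {b. {fst b, snd b} = e} \<and> card {b. {fst b, snd b} = e} \<le> 2" for e :: "nat set"
  proof (cases "\<exists>u v. e = {u, v}")
    case True
    then obtain u v where "e = {u, v}"
      by blast
    then have sub: "{b. {fst b, snd b} = e} \<subseteq> {(u, v), (v, u)}"
      by (auto simp: doubleton_eq_iff)
    then have "card {b. {fst b, snd b} = e} \<le> card {(u, v), (v, u)}"
      by (rule card_mono[rotated]) simp
    also have "\<dots> \<le> 2"
      using card_length[of "[(u, v), (v, u)]"] by simp
    finally show ?thesis
      using sub finite_subset by blast
  next
    case False
    then have "{b. {fst b, snd b} = e} = {}"
      by blast
    then show ?thesis
      by simp
  qed
  have "directed_cycle_bonds l \<subseteq> (\<Union>e\<in>?C. {b. {fst b, snd b} = e})"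
    by (auto simp: directed_cycle_bonds_def)
  then have "card (directed_cycle_bonds l) \<le> card (\<Union>e\<in>?C. {b. {fst b, snd b} = e})"
    using finC pair by (intro card_mono) auto
  also have "\<dots> \<le> (\<Sum>e\<in>?C. card {b. {fst b, snd b} = e})"
    by (rule card_UN_le[OF finC])
  also have "\<dots> \<le> (\<Sum>e\<in>?C. 2)"
    using pair by (intro sum_mono) auto
  finally show ?thesis
    by simp
qed

section \<open>Moduli and unitarity of the bond scattering matrix\<close>

text \<open>Column \<open>u\<close> of \<open>\<sigma> v\<close> is a unit vector with one zero and
  \<open>d - 1\<close> entries of modulus \<open>r\<close>, so
  \<open>r^2 = 1 / (d - 1)\<close>.\<close>

lemma equi_transmitting_modulus:
  assumes "equi_transmitting n E \<sigma>" "v < n" "a \<in> nbrs E v" "u \<in> nbrs E v"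
  shows "(cmod (\<sigma> v a u))\<^sup>2 = of_bool (a \<noteq> u) / (d - 1)"
proof -
  obtain r where uni: "vertex_unitary E \<sigma> v" and diag: "\<And>a. a \<in> nbrs E v \<Longrightarrow> \<sigma> v a a = 0"
    and r: "\<And>a b. a \<in> nbrs E v \<Longrightarrow> b \<in> nbrs E v \<Longrightarrow> a \<noteq> b \<Longrightarrow> cmod (\<sigma> v a b) = r"
    using assms(1,2) unfolding equi_transmitting_def by blast
  have "(\<Sum>c\<in>nbrs E v. cnj (\<sigma> v c u) * \<sigma> v c u) = 1"
    using uni assms by (simp add: vertex_unitary_def)
  then have "complex_of_real (\<Sum>c\<in>nbrs E v. (cmod (\<sigma> v c u))\<^sup>2) = 1"
    unfolding of_real_sum complex_norm_square by (simp add: mult.commute)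
  then have "1 = (\<Sum>c\<in>nbrs E v. (cmod (\<sigma> v c u))\<^sup>2)"
    using of_real_eq_1_iff by metis
  also have "\<dots> = (\<Sum>c\<in>nbrs E v - {u}. (cmod (\<sigma> v c u))\<^sup>2)"
    using diag assms(4) by (simp add: sum.remove)
  also have "\<dots> = (\<Sum>c\<in>nbrs E v - {u}. r\<^sup>2)"
    using assms(4) r by (intro sum.cong refl) auto
  also have "\<dots> = (d - 1) * r\<^sup>2"
    using assms by (simp add: card_nbrs)
  finally have "r\<^sup>2 = 1 / (d - 1)"
    using deg by (simp add: field_simps)
  then show ?thesis
    using assms diag r by (cases "a = u") auto
qed

lemma Umat_modulus:
  assumes "equi_transmitting n E \<sigma>" "b \<in> D" "c \<in> D"
  shows "(cmod (Umat L \<sigma> k b c))\<^sup>2 = of_bool (nb b c) / (d - 1)"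
proof (cases "snd b = fst c")
  case True
  have "snd b < n" "snd c \<in> nbrs E (snd b)" "fst b \<in> nbrs E (snd b)"
    using edge[OF D_edge[OF assms(2)]] D_edge[OF assms(3)] True by (auto simp: nbrs_def)
  then show ?thesis
    using True equi_transmitting_modulus[OF assms(1)]
    by (auto simp: Umat_def bond_scat_def nb_def norm_mult)
next
  case False
  then show ?thesis
    by (simp add: Umat_def bond_scat_def nb_def)
qed

text \<open>Rows with different endpoints have disjoint supports. Rows ending at the same
  \<open>v\<close> are columns of \<open>\<sigma> v\<close> up to phases depending only on the row,
  so vertex unitarity applies.\<close>

lemma row_unitary_Umat:
  assumes "equi_transmitting n E \<sigma>"
  shows "row_unitary D (Umat L \<sigma> k)"
  unfolding row_unitary_def
proof (intro ballI)
  fix b b' assume b: "b \<in> D" and b': "b' \<in> D"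
  show "(\<Sum>c\<in>D. Umat L \<sigma> k b c * cnj (Umat L \<sigma> k b' c)) = of_bool (b = b')"
  proof (cases "snd b = snd b'")
    case False
    then have "(\<Sum>c\<in>D. Umat L \<sigma> k b c * cnj (Umat L \<sigma> k b' c)) = 0"
      by (intro sum.neutral) (auto simp: Umat_def bond_scat_def)
    then show ?thesis
      using False by auto
  next
    case True
    define v where "v = snd b"
    define z where "z = exp (\<i> * complex_of_real (k * L b)) * cnj (exp (\<i> * complex_of_real (k * L b')))"
    have v: "v < n" "fst b \<in> nbrs E v" "fst b' \<in> nbrs E v"
      using edge[OF D_edge[OF b]] edge[OF D_edge[OF b']] True
      by (auto simp: nbrs_def v_def)
    have "(\<Sum>c\<in>D. Umat L \<sigma> k b c * cnj (Umat L \<sigma> k b' c))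
        = (\<Sum>c\<in>Pair v ` nbrs E v. Umat L \<sigma> k b c * cnj (Umat L \<sigma> k b' c))"
      by (rule sum.mono_neutral_right)
        (use D_iff in \<open>auto simp: Umat_def bond_scat_def nbrs_def v_def\<close>)
    also have "\<dots> = (\<Sum>w\<in>nbrs E v. z * (cnj (\<sigma> v w (fst b')) * \<sigma> v w (fst b)))"
      using True by (simp add: sum.reindex inj_on_def Umat_def bond_scat_def v_def z_def mult_ac)
    also have "\<dots> = z * of_bool (fst b' = fst b)"
      using assms v unfolding equi_transmitting_def vertex_unitary_def
      by (simp flip: sum_distrib_left)
    also have "\<dots> = of_bool (b = b')"
    proof (cases "b = b'")
      case True
      then have "z = of_real ((cmod (exp (\<i> * complex_of_real (k * L b))))\<^sup>2)"
        unfolding complex_norm_square by (simp add: z_def)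
      then show ?thesis
        using True by simp
    next
      case False
      then show ?thesis
        using \<open>snd b = snd b'\<close> by (auto simp: prod_eq_iff)
    qed
    finally show ?thesis .
  qed
qed

section \<open>Assembling the variance bound\<close>

text \<open>Outside \<open>multi_walk_bonds\<close> the quantum and classical rows coincide; in an
  exceptional row both are probability vectors, so it costs at most
  \<open>2 \<kappa>^2\<close>.\<close>

lemma quantum_correlation_le:
  fixes g :: "nat \<times> nat \<Rightarrow> real" and \<kappa> :: real
  assumes eq: "equi_transmitting n E \<sigma>" and g: "\<And>b. b \<in> D \<Longrightarrow> \<bar>g b\<bar> \<le> \<kappa>" and l: "2 * t \<le> l"
  shows "(\<Sum>b\<in>D. \<Sum>c\<in>D. g b * g c * (cmod (mpow D (Umat L \<sigma> k) t b c))\<^sup>2)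
    \<le> (\<Sum>b\<in>D. g b * (mstep ^^ t) g b) + 4 * \<kappa>\<^sup>2 * (real d - 1) ^ t * card (directed_cycle_bonds l)"
proof -
  let ?u = "\<lambda>b c. (cmod (mpow D (Umat L \<sigma> k) t b c))\<^sup>2" and ?w = "\<lambda>b c. walks t b c / (d - 1) ^ t"
  have good: "(\<Sum>c\<in>D. g b * g c * (?u b c - ?w b c)) = 0" if "b \<in> D - multi_walk_bonds t" for b
    using that Umat_modulus[OF eq]
    by (intro sum.neutral ballI, subst cmod_mpow_unique_walk) (force simp: multi_walk_bonds_def)+
  have bad: "(\<Sum>c\<in>D. g b * g c * (?u b c - ?w b c)) \<le> 2 * \<kappa>\<^sup>2" if b: "b \<in> D" for b
  proof -
    have "(\<Sum>c\<in>D. g b * g c * (?u b c - ?w b c)) \<le> (\<Sum>c\<in>D. \<kappa>\<^sup>2 * (?u b c + ?w b c))"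
    proof (intro sum_mono)
      fix c assume c: "c \<in> D"
      have "g b * g c * (?u b c - ?w b c) \<le> \<bar>g b\<bar> * \<bar>g c\<bar> * \<bar>?u b c - ?w b c\<bar>"
        by (metis abs_ge_self abs_mult)
      also have "\<dots> \<le> \<kappa> * \<kappa> * (?u b c + ?w b c)"
      proof (intro mult_mono)
        have "0 \<le> ?u b c" "0 \<le> ?w b c"
          by auto
        then show "\<bar>?u b c - ?w b c\<bar> \<le> ?u b c + ?w b c"
          by linarith
      qed (use g[OF b] g[OF c] in auto)
      finally show "g b * g c * (?u b c - ?w b c) \<le> \<kappa>\<^sup>2 * (?u b c + ?w b c)"
        by (simp add: power2_eq_square)
    qed
    also have "\<dots> = \<kappa>\<^sup>2 * ((\<Sum>c\<in>D. ?u b c) + (\<Sum>c\<in>D. ?w b c))"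
      by (simp add: sum_distrib_left sum.distrib distrib_left)
    also have "\<dots> = 2 * \<kappa>\<^sup>2"
      using row_unitary_mpow_row_sum[OF finite_D row_unitary_Umat[OF eq] b] walks_row_sum[OF b] by simp
    finally show ?thesis .
  qed
  have "(\<Sum>b\<in>D. \<Sum>c\<in>D. g b * g c * ?u b c) - (\<Sum>b\<in>D. g b * (mstep ^^ t) g b)
      = (\<Sum>b\<in>D. \<Sum>c\<in>D. g b * g c * (?u b c - ?w b c))"
    unfolding sum_subtractf[symmetric]
    by (intro sum.cong refl) (simp add: mstep_pow_eq_walks sum_distrib_left right_diff_distrib sum_subtractf mult_ac)
  also have "\<dots> = (\<Sum>b\<in>multi_walk_bonds t. \<Sum>c\<in>D. g b * g c * (?u b c - ?w b c))"
    using good by (intro sum.mono_neutral_right) (auto simp: multi_walk_bonds_def)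
  also have "\<dots> \<le> (\<Sum>b\<in>multi_walk_bonds t. 2 * \<kappa>\<^sup>2)"
    by (intro sum_mono bad) (auto simp: multi_walk_bonds_def)
  also have "\<dots> = real (card (multi_walk_bonds t)) * (2 * \<kappa>\<^sup>2)"
    by simp
  also have "\<dots> \<le> real (2 * (d - 1) ^ t * card (directed_cycle_bonds l)) * (2 * \<kappa>\<^sup>2)"
    using card_multi_walk_bonds_le[OF l] by (intro mult_right_mono of_nat_mono) auto
  also have "\<dots> = 4 * \<kappa>\<^sup>2 * (real d - 1) ^ t * card (directed_cycle_bonds l)"
    using deg by (simp add: of_nat_diff)
  finally show ?thesis
    by simp
qed

lemma real_observable_bound:
  fixes g :: "nat \<times> nat \<Rightarrow> real" and \<kappa> :: real
  assumes eq: "equi_transmitting n E \<sigma>" and g: "\<And>b. b \<in> D \<Longrightarrow> \<bar>g b\<bar> \<le> \<kappa>"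
    and sum0: "(\<Sum>b\<in>D. g b) = 0" and gap: "spectral_gap \<beta>" and basis: "eigenbasis_family D L \<sigma> \<phi>"
  shows "(real T)\<^sup>2 * (\<Sum>j<card D. (\<Sum>b\<in>D. g b * (cmod (\<phi> k j b))\<^sup>2)\<^sup>2)
    \<le> 8 * d\<^sup>2 * T * \<kappa>\<^sup>2 * card D / \<beta>
      + 32 * \<kappa>\<^sup>2 * (real d - 1) ^ T * card (cycle_bonds n E (2 * T))"
proof -
  let ?P = "card (directed_cycle_bonds (2 * T))"
  have \<beta>: "\<beta> > 0"
    using gap by (simp add: spectral_gap_def)
  have inner: "(\<Sum>t\<le>s. \<Sum>b\<in>D. \<Sum>c\<in>D. g b * g c * (cmod (mpow D (Umat L \<sigma> k) t b c))\<^sup>2)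
      \<le> 4 * d\<^sup>2 / \<beta> * (card D * \<kappa>\<^sup>2) + 4 * \<kappa>\<^sup>2 * ?P * (\<Sum>t\<le>s. (real d - 1) ^ t)" if "s < T" for s
  proof -
    \<comment> \<open>Since \<open>t \<le> s < T\<close>, the bonds on cycles of length at most
      \<open>2 T\<close> serve for all these times at once.\<close>
    have "(\<Sum>t\<le>s. \<Sum>b\<in>D. \<Sum>c\<in>D. g b * g c * (cmod (mpow D (Umat L \<sigma> k) t b c))\<^sup>2)
      \<le> (\<Sum>t\<le>s. (\<Sum>b\<in>D. g b * (mstep ^^ t) g b) + 4 * \<kappa>\<^sup>2 * (real d - 1) ^ t * ?P)"
      using that g by (intro sum_mono quantum_correlation_le eq) auto
    also have "\<dots> = (\<Sum>t\<le>s. \<Sum>b\<in>D. g b * (mstep ^^ t) g b) + 4 * \<kappa>\<^sup>2 * ?P * (\<Sum>t\<le>s. (real d - 1) ^ t)"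
      by (simp add: sum.distrib sum_distrib_left sum_distrib_right mult_ac)
    also have "(\<Sum>t\<le>s. \<Sum>b\<in>D. g b * (mstep ^^ t) g b) \<le> 4 * d\<^sup>2 / \<beta> * (\<Sum>b\<in>D. (g b)\<^sup>2)"
      by (rule correlation_sum_le[OF gap sum0])
    also have "(\<Sum>b\<in>D. (g b)\<^sup>2) \<le> (\<Sum>b\<in>D. \<kappa>\<^sup>2)"
      using g by (intro sum_mono) (metis abs_le_square_iff abs_of_nonneg abs_ge_zero order_trans)
    finally show ?thesis
      using \<beta> by (simp add: mult_left_mono divide_right_mono)
  qed
  have "(real T)\<^sup>2 * (\<Sum>j<card D. (\<Sum>b\<in>D. g b * (cmod (\<phi> k j b))\<^sup>2)\<^sup>2)
    \<le> 2 * (\<Sum>s<T. \<Sum>t\<le>s. \<Sum>b\<in>D. \<Sum>c\<in>D. g b * g c * (cmod (mpow D (Umat L \<sigma> k) t b c))\<^sup>2)"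
    using basis
    by (intro sum_expectation_sq_le row_unitary_Umat eq)
      (auto simp: eigenbasis_family_def inner_D_def of_bool_def)
  also have "\<dots> \<le> 2 * (\<Sum>s<T. 4 * d\<^sup>2 / \<beta> * (card D * \<kappa>\<^sup>2) + 4 * \<kappa>\<^sup>2 * ?P * (\<Sum>t\<le>s. (real d - 1) ^ t))"
    by (intro mult_left_mono sum_mono inner) auto
  also have "\<dots> = 8 * d\<^sup>2 * T * \<kappa>\<^sup>2 * card D / \<beta> + 8 * \<kappa>\<^sup>2 * ?P * (\<Sum>s<T. \<Sum>t\<le>s. (real d - 1) ^ t)"
    by (simp add: sum.distrib sum_distrib_left mult_ac)
  \<comment> \<open>The constant 32 is 8 times 2 for the orientations of a cycle bond and times 2
    for the geometric sums.\<close>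
  also have "\<dots> \<le> 8 * d\<^sup>2 * T * \<kappa>\<^sup>2 * card D / \<beta> + 8 * \<kappa>\<^sup>2 * (2 * card (cycle_bonds n E (2 * T))) * (2 * (real d - 1) ^ T)"
    using deg card_directed_cycle_bonds_le[of "2 * T"]
    by (intro add_left_mono mult_mono sum_sum_power_le) (auto intro!: sum_nonneg)
  finally show ?thesis
    by (simp add: mult_ac)
qed

lemma qv_integrand_le:
  fixes \<kappa> :: real
  assumes eq: "equi_transmitting n E \<sigma>" and f: "\<And>b. b \<in> D \<Longrightarrow> cmod (f b) < \<kappa>"
    and D0: "card D > 0" and gap: "spectral_gap \<beta>" and basis: "eigenbasis_family D L \<sigma> \<phi>"
  shows "(real T)\<^sup>2 * qv_integrand D f \<phi> k
    \<le> 64 * d\<^sup>2 * T * \<kappa>\<^sup>2 * card D / \<beta>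
      + 256 * \<kappa>\<^sup>2 * (real d - 1) ^ T * card (cycle_bonds n E (2 * T))"
proof -
  define \<mu> where "\<mu> = (\<Sum>b\<in>D. f b) / of_nat (card D)"
  define g where "g b = f b - \<mu>" for b
  have "cmod (\<Sum>b\<in>D. f b) \<le> (\<Sum>b\<in>D. \<kappa>)"
    by (rule order_trans[OF norm_sum sum_mono]) (use f in \<open>auto intro: less_imp_le\<close>)
  then have \<mu>: "cmod \<mu> \<le> \<kappa>"
    using D0 by (simp add: \<mu>_def norm_divide divide_le_eq mult.commute)
  have g: "cmod (g b) \<le> 2 * \<kappa>" if "b \<in> D" for b
    using norm_triangle_ineq4[of "f b" \<mu>] f[OF that] \<mu> by (simp add: g_def)
  have "(\<Sum>b\<in>D. g b) = 0"
    using D0 by (simp add: g_def sum_subtractf \<mu>_def)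
  then have g0: "(\<Sum>b\<in>D. Re (g b)) = 0" "(\<Sum>b\<in>D. Im (g b)) = 0"
    by (simp_all flip: Re_sum Im_sum)
  \<comment> \<open>The mean moves inside because \<open>\<phi> k j\<close> is normalised; the real
    weights \<open>|\<phi>|^2\<close> then separate real and imaginary parts.\<close>
  have split: "(cmod (inner_D D (\<phi> k j) (\<lambda>b. f b * \<phi> k j b) - \<mu>))\<^sup>2
      = (\<Sum>b\<in>D. Re (g b) * (cmod (\<phi> k j b))\<^sup>2)\<^sup>2 + (\<Sum>b\<in>D. Im (g b) * (cmod (\<phi> k j b))\<^sup>2)\<^sup>2"
    if "j < card D" for j
  proof -
    have one: "(\<Sum>b\<in>D. cnj (\<phi> k j b) * \<phi> k j b) = 1"
      using basis that by (simp add: eigenbasis_family_def inner_D_def)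
    have "inner_D D (\<phi> k j) (\<lambda>b. f b * \<phi> k j b) - \<mu>
        = (\<Sum>b\<in>D. cnj (\<phi> k j b) * (f b * \<phi> k j b)) - \<mu> * (\<Sum>b\<in>D. cnj (\<phi> k j b) * \<phi> k j b)"
      by (simp add: one inner_D_def)
    also have "\<dots> = (\<Sum>b\<in>D. g b * (\<phi> k j b * cnj (\<phi> k j b)))"
      by (simp add: g_def sum_distrib_left algebra_simps flip: sum_subtractf)
    also have "\<dots> = (\<Sum>b\<in>D. g b * of_real ((cmod (\<phi> k j b))\<^sup>2))"
      by (simp only: complex_norm_square)
    finally show ?thesis
      by (simp add: cmod_power2)
  qed
  have "(real T)\<^sup>2 * qv_integrand D f \<phi> k
      = (real T)\<^sup>2 * (\<Sum>j<card D. (\<Sum>b\<in>D. Re (g b) * (cmod (\<phi> k j b))\<^sup>2)\<^sup>2)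
        + (real T)\<^sup>2 * (\<Sum>j<card D. (\<Sum>b\<in>D. Im (g b) * (cmod (\<phi> k j b))\<^sup>2)\<^sup>2)"
    unfolding qv_integrand_def \<mu>_def[symmetric] by (simp add: split sum.distrib distrib_left)
  \<comment> \<open>Both parts are bounded by \<open>2 \<kappa>\<close> and there are two of them,
    which multiplies each constant by 8.\<close>
  also have "\<dots> \<le> (8 * d\<^sup>2 * T * (2 * \<kappa>)\<^sup>2 * card D / \<beta>
        + 32 * (2 * \<kappa>)\<^sup>2 * (real d - 1) ^ T * card (cycle_bonds n E (2 * T)))
      + (8 * d\<^sup>2 * T * (2 * \<kappa>)\<^sup>2 * card D / \<beta>
        + 32 * (2 * \<kappa>)\<^sup>2 * (real d - 1) ^ T * card (cycle_bonds n E (2 * T)))"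
    by (intro add_mono real_observable_bound[OF eq _ _ gap basis] g0)
      (auto intro: order_trans[OF abs_Re_le_cmod g] order_trans[OF abs_Im_le_cmod g])
  finally show ?thesis
    by (simp add: power_mult_distrib algebra_simps)
qed

end

theorem theorem1:
  fixes d :: nat
  assumes "d > 3"
  shows "\<exists>c::real. \<forall>(n::nat) (E::nat \<Rightarrow> nat \<Rightarrow> bool) (L::nat \<times> nat \<Rightarrow> real)
      (\<sigma>::nat \<Rightarrow> nat \<Rightarrow> nat \<Rightarrow> complex) (f::nat \<times> nat \<Rightarrow> complex) (\<kappa>::real) (T::nat) (\<beta>::real)
      (\<phi>::real \<Rightarrow> nat \<Rightarrow> nat \<times> nat \<Rightarrow> complex).
    simple_graph n E \<and> regular n E d \<and> connected_graph n E \<and> \<not> bipartite n E \<and>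
    bond_lengths n E L \<and> equi_transmitting n E \<sigma> \<and>
    \<kappa> > 0 \<and> (\<forall>b\<in>dbonds n E. cmod (f b) < \<kappa>) \<and>
    T > 0 \<and> \<beta> > 0 \<and> (\<forall>\<mu>. conn_eigenvalue n E \<mu> \<and> \<mu> \<noteq> real d \<longrightarrow> \<bar>\<mu>\<bar> \<le> real d - \<beta>) \<and>
    eigenbasis_family (dbonds n E) L \<sigma> \<phi> \<and>
    (\<forall>K. qv_integrand (dbonds n E) f \<phi> integrable_on {0..K})
    \<longrightarrow> quantum_variance (dbonds n E) f \<phi> \<le>
        ereal (c * (\<kappa>\<^sup>2 / (real T * \<beta>\<^sup>2) +
          \<kappa>\<^sup>2 * (real d - 1) ^ T * real (card (cycle_bonds n E (2 * T)))
            / (real (card (ubonds n E)) * (real T)\<^sup>2)))"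
proof (intro exI allI impI, elim conjE)
  fix n E L \<sigma> f \<kappa> T \<beta> \<phi>
  assume "simple_graph n E" "regular n E d" and conn: "connected_graph n E"
    and eq: "equi_transmitting n E \<sigma>" and \<kappa>: "(\<kappa>::real) > 0"
    and f: "\<forall>b\<in>dbonds n E. cmod (f b) < \<kappa>" and T: "(T::nat) > 0" and \<beta>: "\<beta> > 0"
    and ev: "\<forall>\<mu>. conn_eigenvalue n E \<mu> \<and> \<mu> \<noteq> real d \<longrightarrow> \<bar>\<mu>\<bar> \<le> real d - \<beta>"
    and basis: "eigenbasis_family (dbonds n E) L \<sigma> \<phi>"
    and int: "\<forall>K. qv_integrand (dbonds n E) f \<phi> integrable_on {0..K}"
  then interpret regular_simple_graph n d E
    using assms by unfold_locales
  define N where "N = real (card D)"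
  define B where "B = real (card (ubonds n E))"
  define Z where "Z = \<kappa>\<^sup>2 * (real d - 1) ^ T * real (card (cycle_bonds n E (2 * T)))"
  \<comment> \<open>\<open>64 d^3\<close> is \<open>64 d^2\<close> times the factor \<open>d\<close>
    from \<open>1 / \<beta> \<le> d / \<beta>^2\<close>; 256 is the constant of the cycle
    term.\<close>
  define c where "c = 64 * real d ^ 3 + 256"
  define M where "M = (64 * d\<^sup>2 * T * \<kappa>\<^sup>2 * N / \<beta> + 256 * Z) / (real T)\<^sup>2"
  have gap: "spectral_gap \<beta>"
    using spectral_gap_of_eigenvalues[OF conn \<beta>] ev by blast
  then have \<beta>d: "\<beta> \<le> d"
    by (simp add: spectral_gap_def)
  \<comment> \<open>Vertex 0 has \<open>d > 0\<close> neighbours, so there is a bond and the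
    divisors \<open>N\<close> and \<open>B\<close> are positive.\<close>
  have "n > 0"
    using conn by (simp add: connected_graph_def)
  then have "nbrs E 0 \<noteq> {}"
    using card_nbrs[of 0] deg by auto
  then obtain w where "(0, w) \<in> D"
    by (auto simp: nbrs_def D_iff)
  then have "card D > 0" "{0, w} \<in> ubonds n E"
    by (auto simp: card_gt_0_iff ubonds_def)
  then have "card (ubonds n E) > 0"
    using finite_ubonds by (auto simp: card_gt_0_iff)
  then have BN: "0 < B" "B \<le> N" "0 < N"
    using card_ubonds_le \<open>card D > 0\<close> by (auto simp: B_def N_def)
  have Z0: "0 \<le> Z"
    using deg by (simp add: Z_def)
  have pointwise: "qv_integrand D f \<phi> k \<le> M" for k
    using qv_integrand_le[OF eq _ \<open>card D > 0\<close> gap basis, of f \<kappa> T k] f T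
    by (simp add: M_def N_def Z_def le_divide_eq mult_ac)
  have MN: "M / N \<le> c * (\<kappa>\<^sup>2 / (real T * \<beta>\<^sup>2) + Z / (B * (real T)\<^sup>2))"
  proof -
    have "M / N = 64 * d\<^sup>2 * \<kappa>\<^sup>2 / (T * \<beta>) + 256 * (Z / (N * (real T)\<^sup>2))"
      using BN T \<beta> by (simp add: M_def add_divide_distrib power2_eq_square mult_ac)
    also have "64 * d\<^sup>2 * \<kappa>\<^sup>2 / (T * \<beta>) \<le> 64 * real d ^ 3 * (\<kappa>\<^sup>2 / (real T * \<beta>\<^sup>2))"
    proof -
      have "64 * d\<^sup>2 * \<kappa>\<^sup>2 / (T * \<beta>) = 64 * (real d)\<^sup>2 * \<beta> * (\<kappa>\<^sup>2 / (real T * \<beta>\<^sup>2))"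
        using \<beta> by (simp add: power2_eq_square)
      also have "\<dots> \<le> 64 * (real d)\<^sup>2 * real d * (\<kappa>\<^sup>2 / (real T * \<beta>\<^sup>2))"
        using \<beta>d by (intro mult_right_mono mult_left_mono) auto
      finally show ?thesis
        by (simp add: power3_eq_cube power2_eq_square)
    qed
    also have "64 * real d ^ 3 * (\<kappa>\<^sup>2 / (real T * \<beta>\<^sup>2)) \<le> c * (\<kappa>\<^sup>2 / (real T * \<beta>\<^sup>2))"
      by (intro mult_right_mono) (auto simp: c_def)
    also have "256 * (Z / (N * (real T)\<^sup>2)) \<le> c * (Z / (B * (real T)\<^sup>2))"
      using BN T Z0 by (intro mult_mono divide_left_mono mult_right_mono) (auto simp: c_def)
    finally show ?thesis
      by (simp add: distrib_left)
  qed
  \<comment> \<open>The bound holds at every \<open>k\<close>, so it survives averaging over any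
    \<open>[0, K]\<close> with \<open>K > 0\<close>, and then the limit superior.\<close>
  have "eventually (\<lambda>K::real. ereal (1 / real (card D) * (1 / K * integral {0..K} (qv_integrand D f \<phi>)))
      \<le> ereal (M / N)) at_top"
    using eventually_gt_at_top[of "0::real"]
  proof eventually_elim
    case (elim K)
    have "integral {0..K} (qv_integrand D f \<phi>) \<le> integral {0..K} (\<lambda>_. M)"
      using int by (intro integral_le pointwise) auto
    also have "\<dots> = K * M"
      using elim by simp
    finally have "1 / K * integral {0..K} (qv_integrand D f \<phi>) \<le> M"
      using elim by (simp add: divide_le_eq mult.commute)
    then have "1 / N * (1 / K * integral {0..K} (qv_integrand D f \<phi>)) \<le> 1 / N * M"
      using BN by (intro mult_left_mono) auto
    then show ?case
      by (simp add: N_def)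
  qed
  then have "quantum_variance D f \<phi> \<le> ereal (M / N)"
    unfolding quantum_variance_def by (rule Limsup_bounded)
  also have "\<dots> \<le> ereal (c * (\<kappa>\<^sup>2 / (real T * \<beta>\<^sup>2) + Z / (B * (real T)\<^sup>2)))"
    using MN by simp
  finally show "quantum_variance D f \<phi> \<le> ereal ((64 * real d ^ 3 + 256) * (\<kappa>\<^sup>2 / (real T * \<beta>\<^sup>2) +
      \<kappa>\<^sup>2 * (real d - 1) ^ T * real (card (cycle_bonds n E (2 * T))) / (real (card (ubonds n E)) * (real T)\<^sup>2)))"
    by (simp add: c_def Z_def B_def)
qed

end
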